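(* Let $X_1,X_2,\dots$ be i.i.d. real-valued continuous random variables and let $\alpha\in\overline{\mathbb{H}}$. For $n\ge m$ let $$R^{(\alpha)}_{m,n}=\frac{1}{\binom nm}\sum_{1\le\ell_1<\cdots<\ell_m\le n}\left(\prod_{j=1}^m (X_{\ell_j}+\alpha)^{1/m}-\alpha\right),\qquad G^{(\alpha)}_m=\prod_{j=1}^m (X_j+\alpha)^{1/m}-\alpha.$$ Let $m\ge2$ and $X_1\in L^{\frac{2m}{2m+1}}$. Then: (i) The following convergence holds almost surely and in $L^{m-1}$: $$\lim_{n\to\infty}R^{(\alpha)}_{m,n}=E\left[G^{(\alpha)}_m\right].$$ (ii) For $n\ge m$, $$m\,\mathrm{Var}\left(G^{(\alpha)}_m\right)\frac{\left|E\left[(X_1+\alpha)^{1/m}\right]\right|^{2m}}{E\left[|X_1+\alpha|^{2/m}\right]^m}\le n\,\mathrm{Var}\left(R^{(\alpha)}_{m,n}\right)\le m\,\mathrm{Var}\left(G^{(\alpha)}_m\right).$$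
   Context: $\overline{\mathbb{H}}=\{z\in\mathbb{C}:\mathrm{Im}(z)\ge0\}$ is the closed upper half-plane. Complex powers use the principal branch: $z^q=\exp(q\log z)$ with $\log z=\log r+i\theta$ for $z=r e^{i\theta}$, $r>0$, $\theta\in(-\pi,\pi]$; $0^q=0$ for $0<q<1$. For a complex-valued random variable $Y$ and $s>0$, $Y\in L^s$ means $E[|Y|^s]<+\infty$; $E[Y]=E[\mathrm{Re}(Y)]+iE[\mathrm{Im}(Y)]$ and $\mathrm{Var}(Y)=E[|Y-E[Y]|^2]$. *)

theory Defs
  imports "HOL-Probability.Probability"
begin

text \<open>On complex numbers, \<^term>\<open>z powr q\<close> is \<open>exp (q * Ln z)\<close> with \<open>Im (Ln z)\<close> in \<open>(-pi, pi]\<close>,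
  and \<open>0 powr q = 0\<close>: this is exactly the principal branch intended here.\<close>

definition root_rv :: "complex \<Rightarrow> nat \<Rightarrow> real \<Rightarrow> complex" where
  "root_rv \<alpha> m x = (complex_of_real x + \<alpha>) powr complex_of_real (1 / real m)"

definition G_stat :: "(nat \<Rightarrow> 'a \<Rightarrow> real) \<Rightarrow> complex \<Rightarrow> nat \<Rightarrow> 'a \<Rightarrow> complex" where
  "G_stat X \<alpha> m \<omega> = (\<Prod>j\<in>{1..m}. root_rv \<alpha> m (X j \<omega>)) - \<alpha>"

text \<open>Index tuples \<open>1 \<le> l\<^sub>1 < \<dots> < l\<^sub>m \<le> n\<close> are encoded as the \<open>m\<close>-element subsets of \<open>{1..n}\<close>;
  for \<open>n < m\<close> the statistic is \<open>0\<close>.\<close>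

definition R_stat :: "(nat \<Rightarrow> 'a \<Rightarrow> real) \<Rightarrow> complex \<Rightarrow> nat \<Rightarrow> nat \<Rightarrow> 'a \<Rightarrow> complex" where
  "R_stat X \<alpha> m n \<omega> =
     1 / of_nat (n choose m) *
       (\<Sum>L \<in> {L. L \<subseteq> {1..n} \<and> card L = m}. (\<Prod>l\<in>L. root_rv \<alpha> m (X l \<omega>)) - \<alpha>)"

definition L_space :: "'a measure \<Rightarrow> real \<Rightarrow> ('a \<Rightarrow> 'b::real_normed_vector) set" where
  "L_space M s = {Y \<in> borel_measurable M. (\<integral>\<^sup>+ \<omega>. ennreal (norm (Y \<omega>) powr s) \<partial>M) < \<infinity>}"

definition tendsto_L ::
  "'a measure \<Rightarrow> real \<Rightarrow> (nat \<Rightarrow> 'a \<Rightarrow> 'b::real_normed_vector) \<Rightarrow> ('a \<Rightarrow> 'b) \<Rightarrow> bool" where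
  "tendsto_L M s Y Z \<longleftrightarrow>
     (\<forall>n. Y n \<in> L_space M s) \<and> Z \<in> L_space M s \<and>
     (\<lambda>n. \<integral>\<^sup>+ \<omega>. ennreal (norm (Y n \<omega> - Z \<omega>) powr s) \<partial>M) \<longlonglongrightarrow> 0"

text \<open>The variance takes values in \<open>[0, \<infinity>]\<close>, so that it is infinite, and not a default value,
  for an integrable variable without second moment. In an inequality between such quantities,
  \<open>ennreal\<close> conventions apply: \<open>c / \<infinity> = 0\<close> for finite \<open>c\<close>, and \<open>\<infinity> * 0 = 0\<close>.\<close>

definition cvariance :: "'a measure \<Rightarrow> ('a \<Rightarrow> complex) \<Rightarrow> ennreal" where
  "cvariance M Y = (\<integral>\<^sup>+ \<omega>. ennreal ((cmod (Y \<omega> - integral\<^sup>L M Y))\<^sup>2) \<partial>M)"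

text \<open>A continuous random variable: its law has no atoms, i.e. its distribution function is
  continuous. A density is not required.\<close>

definition continuous_rv :: "'a measure \<Rightarrow> ('a \<Rightarrow> real) \<Rightarrow> bool" where
  "continuous_rv M Y \<longleftrightarrow>
     Y \<in> borel_measurable M \<and> (\<forall>x. measure M {\<omega> \<in> space M. Y \<omega> = x} = 0)"

end

theory Submission
  imports Defs
begin

text \<open>
  Let \<open>Y\<^sub>i = (X\<^sub>i + \<alpha>) powr (1/m)\<close> and let \<open>\<mu>\<close> be the mean of \<open>Y\<^sub>1\<close>. The statistic \<open>R\<close> is, up to the
  constant \<open>\<alpha>\<close>, the mean of the products of \<open>Y\<close> over all \<open>m\<close>-subsets of \<open>{1..n}\<close>, that is, the \<open>m\<close>-th
  elementary symmetric function of \<open>Y\<^sub>1, \<dots>, Y\<^sub>n\<close> divided by \<open>n choose m\<close>. The moment assumption on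
  \<open>X\<^sub>1\<close> says that \<open>Y\<^sub>1\<close> has an absolute moment of order \<open>p = 2m\<^sup>2 / (2m + 1)\<close>, and this order is larger than
  both \<open>1\<close> and \<open>m - 1\<close>.

  Almost sure convergence holds because an elementary symmetric function is nearly a power of the first
  power sum. By Newton's identities the two differ, after normalisation, by terms in which an index is
  repeated, and these are controlled by the sum of the squares \<open>|Y\<^sub>i|\<^sup>2\<close> divided by \<open>n\<^sup>2\<close>, which tends to
  \<open>0\<close> whenever the averages of \<open>|Y\<^sub>i|\<close> converge (\<open>sum_squares_negligible\<close>, \<open>Newton_defect_bound\<close>). So
  the purely deterministic lemma \<open>esym_mean_tendsto\<close> reduces the claim to the strong law of large numbers
  for \<open>Y\<^sub>i\<close> and \<open>|Y\<^sub>i|\<close>. The strong law is proved for variables with a moment of order greater than \<open>1\<close>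
  (\<open>strong_law_nonneg\<close>), by truncation, a variance estimate along the subsequence \<open>j ^ r\<close>, and
  interpolation.

  Convergence in order \<open>m - 1\<close> follows since the moments of order \<open>p\<close> of the statistics are bounded:
  by convexity they are dominated by the moment of a single product, which factorises
  (\<open>symmetric_mean_moment_bound\<close>), and \<open>p > m - 1\<close> gives uniform integrability
  (\<open>moment_tendsto_0_of_AE_of_bounded_moment\<close>).

  For the variances, let \<open>s\<close> be the mean of \<open>|Y\<^sub>1|\<^sup>2\<close> and \<open>t = |\<mu>|\<^sup>2\<close>. The products over \<open>L\<close> and \<open>L'\<close> have
  covariance \<open>f k = s ^ k * t ^ (m - k) - t ^ m\<close>, where \<open>k\<close> is the size of \<open>L \<inter> L'\<close>. Since \<open>f\<close> is convex with
  \<open>f 0 = 0\<close>, it satisfies \<open>k * f 1 \<le> f k \<le> (k / m) * f m\<close>, and only the mean overlap of two random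
  \<open>m\<close>-subsets enters, which is \<open>m\<^sup>2 / n\<close> (\<open>overlap_covariance_bounds\<close>, \<open>sum_card_intersections\<close>). This
  gives \<open>m\<^sup>2 * f 1 \<le> n Var R \<le> m * f m\<close>, where \<open>f m\<close> is the variance of \<open>G\<close>, and the elementary estimate
  \<open>variance_ratio_bound\<close> compares \<open>m * f 1\<close> with \<open>f m * t ^ m / s ^ m\<close>. For \<open>m = 2\<close> the second moment of
  \<open>Y\<^sub>1\<close> may be infinite; then the lower bound is \<open>0\<close> and the upper bound is infinite.
\<close>

section \<open>Averages of a deterministic sequence\<close>

lemma Cesaro_mean_tendsto:
  fixes a :: "nat \<Rightarrow> 'a::real_normed_field"
  assumes "a \<longlonglongrightarrow> L"
  shows "(\<lambda>n. (\<Sum>i=1..n. a i) / of_nat n) \<longlonglongrightarrow> L"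
proof (rule LIMSEQ_I)
  fix e :: real assume e: "e > 0"
  obtain N where N: "\<And>i. i \<ge> N \<Longrightarrow> norm (a i - L) < e / 2"
    using LIMSEQ_D[OF assms, of "e/2"] e by auto
  define C where "C = (\<Sum>i\<in>{1..N}. norm (a i - L))"
  have C0: "C \<ge> 0" unfolding C_def by (intro sum_nonneg) auto
  obtain N' :: nat where N': "real N' > 2 * C / e" using reals_Archimedean2 by blast
  show "\<exists>no. \<forall>n\<ge>no. norm ((\<Sum>i=1..n. a i) / of_nat n - L) < e"
  proof (intro exI allI impI)
    fix n assume n: "n \<ge> max (max N N') 1"
    have "norm (\<Sum>i=1..n. a i - L) \<le> (\<Sum>i\<in>{1..n}. norm (a i - L))" by (rule norm_sum)
    also have "\<dots> \<le> (\<Sum>i\<in>{1..n}. (if i \<le> N then norm (a i - L) else 0) + e / 2)"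
      using N e by (intro sum_mono) (auto simp: less_imp_le)
    also have "\<dots> = (\<Sum>i\<in>{1..n}. if i \<le> N then norm (a i - L) else 0) + real n * (e / 2)"
      by (simp add: sum.distrib)
    also have "(\<Sum>i\<in>{1..n}. if i \<le> N then norm (a i - L) else 0) = C"
      unfolding C_def using n by (intro sum.mono_neutral_cong_right) auto
    finally have 1: "norm (\<Sum>i=1..n. a i - L) \<le> C + real n * (e / 2)" .
    have "C < real n * (e / 2)"
    proof -
      have "2 * C / e < real n" using N' n by linarith
      then show ?thesis using e by (simp add: field_simps)
    qed
    with 1 have 2: "norm (\<Sum>i=1..n. a i - L) < real n * e" by simp
    have "(\<Sum>i=1..n. a i) / of_nat n - L = (\<Sum>i=1..n. a i - L) / of_nat n"
      using n by (simp add: sum_subtractf field_simps)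
    then have "norm ((\<Sum>i=1..n. a i) / of_nat n - L) = norm (\<Sum>i=1..n. a i - L) / real n"
      by (simp add: norm_divide)
    also have "\<dots> < e" using 2 n by (simp add: field_simps)
    finally show "norm ((\<Sum>i=1..n. a i) / of_nat n - L) < e" .
  qed
qed

lemma ex_floor_root:
  fixes n r :: nat
  assumes "r > 0"
  shows "\<exists>j. j ^ r \<le> n \<and> n < Suc j ^ r"
proof -
  define j where "j = (LEAST j. n < Suc j ^ r)"
  have "n < Suc n ^ r" using assms
    by (metis One_nat_def Suc_le_eq less_Suc_eq_le order.strict_trans2 lessI power_one_right power_increasing zero_less_Suc)
  then have 1: "n < Suc j ^ r" unfolding j_def by (rule LeastI)
  have "j ^ r \<le> n"
  proof (cases j)
    case 0 then show ?thesis using assms by (simp add: zero_power)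
  next
    case (Suc i)
    then have "\<not> n < Suc i ^ r" unfolding j_def by (intro not_less_Least) simp
    then show ?thesis using Suc by simp
  qed
  with 1 show ?thesis by blast
qed

text \<open>For a monotone sequence of partial sums, convergence of the averages along a subsequence whose
consecutive ratios tend to \<open>1\<close> forces convergence of all averages: \<open>n\<close> is squeezed between
\<open>j ^ r\<close> and \<open>(j + 1) ^ r\<close>. The exponent \<open>r\<close> is left free because the strong law below needs a sparser
subsequence the fewer moments are available.\<close>
lemma average_tendsto_from_powers:
  fixes S :: "nat \<Rightarrow> real"
  assumes r: "r > 0" and mono: "mono S" and nonneg: "\<And>n. 0 \<le> S n"
    and lim: "(\<lambda>j. S (j ^ r) / real (j ^ r)) \<longlonglongrightarrow> L"
  shows "(\<lambda>n. S n / real n) \<longlonglongrightarrow> L"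
proof -
  obtain J where J: "\<And>n. J n ^ r \<le> n" "\<And>n. n < Suc (J n) ^ r"
    using ex_floor_root[OF r] by metis
  have Jtop: "filterlim J at_top sequentially"
    unfolding filterlim_at_top eventually_sequentially
  proof (intro allI exI impI)
    fix k n :: nat assume "k ^ r \<le> n"
    then have "k ^ r < Suc (J n) ^ r" using J(2)[of n] by linarith
    then show "k \<le> J n" using power_less_imp_less_base by fastforce
  qed
  have ratio: "(\<lambda>j. (real (Suc j) / real j) ^ r) \<longlonglongrightarrow> 1 ^ r"
    by (intro tendsto_power LIMSEQ_Suc_n_over_n)
  have up: "(\<lambda>j. S (Suc j ^ r) / real (Suc j ^ r) * (real (Suc j) / real j) ^ r) \<longlonglongrightarrow> L * 1 ^ r"
    by (intro tendsto_mult ratio LIMSEQ_Suc[OF lim])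
  have lo: "(\<lambda>j. S (j ^ r) / real (j ^ r) / (real (Suc j) / real j) ^ r) \<longlonglongrightarrow> L / 1 ^ r"
    by (intro tendsto_divide ratio lim) auto
  have ev: "eventually (\<lambda>n. J n \<ge> 1) sequentially"
    using Jtop unfolding filterlim_at_top by blast
  show ?thesis
  proof (rule tendsto_sandwich)
    show "eventually (\<lambda>n. S (J n ^ r) / real (J n ^ r) / (real (Suc (J n)) / real (J n)) ^ r \<le> S n / real n) sequentially"
      using ev
    proof eventually_elim
      case (elim n)
      have n: "n > 0" using J(1)[of n] elim by (metis gr0I le_zero_eq not_one_le_zero power_eq_0_iff)
      have "S (J n ^ r) / real (J n ^ r) / (real (Suc (J n)) / real (J n)) ^ r = S (J n ^ r) / real (Suc (J n) ^ r)"
        using elim by (simp add: power_divide)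
      also have "\<dots> \<le> S n / real n"
        using n J[of n] monoD[OF mono J(1)[of n]] nonneg
        by (intro frac_le) (auto simp del: of_nat_power of_nat_Suc intro: less_imp_le)
      finally show ?case .
    qed
    show "eventually (\<lambda>n. S n / real n \<le> S (Suc (J n) ^ r) / real (Suc (J n) ^ r) * (real (Suc (J n)) / real (J n)) ^ r) sequentially"
      using ev
    proof eventually_elim
      case (elim n)
      have "S n / real n \<le> S (Suc (J n) ^ r) / real (J n ^ r)"
        using elim J[of n] monoD[OF mono less_imp_le[OF J(2)[of n]]] nonneg
        by (intro frac_le) (auto simp del: of_nat_power of_nat_Suc)
      also have "\<dots> = S (Suc (J n) ^ r) / real (Suc (J n) ^ r) * (real (Suc (J n)) / real (J n)) ^ r"
        using elim by (simp add: power_divide del: of_nat_Suc)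
      finally show ?case .
    qed
    show "(\<lambda>n. S (J n ^ r) / real (J n ^ r) / (real (Suc (J n)) / real (J n)) ^ r) \<longlonglongrightarrow> L"
      using filterlim_compose[OF lo Jtop] by simp
    show "(\<lambda>n. S (Suc (J n) ^ r) / real (Suc (J n) ^ r) * (real (Suc (J n)) / real (J n)) ^ r) \<longlonglongrightarrow> L"
      using filterlim_compose[OF up Jtop] by simp
  qed
qed

lemma average_last_term_negligible:
  fixes y :: "nat \<Rightarrow> real"
  assumes "(\<lambda>n. (\<Sum>i=1..n. y i) / real n) \<longlonglongrightarrow> c"
  shows "(\<lambda>n. y n / real n) \<longlonglongrightarrow> 0"
proof (rule LIMSEQ_imp_Suc)
  let ?A = "\<lambda>n. (\<Sum>i=1..n. y i) / real n"
  have "(\<lambda>n. ?A (Suc n) - ?A n * (real n / real (Suc n))) \<longlonglongrightarrow> c - c * 1"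
    by (intro tendsto_diff tendsto_mult assms LIMSEQ_Suc[OF assms] LIMSEQ_n_over_Suc_n)
  moreover have "?A (Suc n) - ?A n * (real n / real (Suc n)) = y (Suc n) / real (Suc n)" for n
  proof (cases "n = 0")
    case False
    then have "?A n * (real n / real (Suc n)) = (\<Sum>i=1..n. y i) / real (Suc n)" by simp
    then show ?thesis by (simp add: add_divide_distrib)
  qed simp
  ultimately show "(\<lambda>n. y (Suc n) / real (Suc n)) \<longlonglongrightarrow> 0" by simp
qed

text \<open>This controls the diagonal terms of a \<open>U\<close>-statistic. Convergence of the averages already makes
\<open>y n / n\<close> small, so \<open>(y i)\<^sup>2\<close> is at most \<open>d * n * y i\<close> for all but finitely many \<open>i \<le> n\<close>, and the sum
of these bounds is \<open>d\<close> times a quantity of order \<open>n\<^sup>2\<close>.\<close>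
lemma sum_squares_negligible:
  fixes y :: "nat \<Rightarrow> real"
  assumes nonneg: "\<And>i. 0 \<le> y i" and avg: "(\<lambda>n. (\<Sum>i=1..n. y i) / real n) \<longlonglongrightarrow> c"
  shows "(\<lambda>n. (\<Sum>i=1..n. (y i)\<^sup>2) / real n ^ 2) \<longlonglongrightarrow> 0"
proof (rule LIMSEQ_I)
  fix e :: real assume e: "e > 0"
  obtain B where B: "B > 0" "\<And>n. \<bar>(\<Sum>i=1..n. y i) / real n\<bar> \<le> B"
    using convergent_imp_Bseq[OF convergentI[OF avg]] by (auto elim!: BseqE)
  define d where "d = e / (2 * B)"
  have d: "d > 0" using e B by (simp add: d_def)
  obtain N where N: "\<And>i. i \<ge> N \<Longrightarrow> \<bar>y i / real i\<bar> < d"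
    using LIMSEQ_D[OF average_last_term_negligible[OF avg] d] by auto
  define C where "C = (\<Sum>i\<in>{1..N}. (y i)\<^sup>2)"
  have C0: "C \<ge> 0" unfolding C_def by (intro sum_nonneg) auto
  obtain N' :: nat where N': "real N' > 2 * C / e" using reals_Archimedean2 by blast
  show "\<exists>no. \<forall>n\<ge>no. norm ((\<Sum>i=1..n. (y i)\<^sup>2) / real n ^ 2 - 0) < e"
  proof (intro exI allI impI)
    fix n assume n: "n \<ge> max (max N N') 1"
    have "(\<Sum>i=1..n. (y i)\<^sup>2) \<le> (\<Sum>i\<in>{1..n}. (if i \<le> N then (y i)\<^sup>2 else 0) + d * real n * y i)"
    proof (rule sum_mono)
      fix i assume i: "i \<in> {1..n}"
      show "(y i)\<^sup>2 \<le> (if i \<le> N then (y i)\<^sup>2 else 0) + d * real n * y i"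
      proof (cases "i \<le> N")
        case True then show ?thesis using d nonneg by simp
      next
        case False
        then have "y i / real i < d" using N[of i] abs_ge_self[of "y i / real i"] by linarith
        then have "y i \<le> d * real i" using i by (simp add: field_simps)
        also have "\<dots> \<le> d * real n" using i d by simp
        finally show ?thesis using False nonneg[of i] by (simp add: power2_eq_square mult_right_mono)
      qed
    qed
    also have "\<dots> = (\<Sum>i\<in>{1..n}. if i \<le> N then (y i)\<^sup>2 else 0) + d * real n * (\<Sum>i=1..n. y i)"
      by (simp add: sum.distrib sum_distrib_left)
    also have "(\<Sum>i\<in>{1..n}. if i \<le> N then (y i)\<^sup>2 else 0) = C"
      unfolding C_def using n by (intro sum.mono_neutral_cong_right) auto
    also have "d * real n * (\<Sum>i=1..n. y i) \<le> d * real n * (B * real n)"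
    proof -
      have "(\<Sum>i=1..n. y i) / real n \<le> B" using B(2)[of n] by linarith
      then show ?thesis using n d by (intro mult_left_mono) (auto simp: field_simps)
    qed
    also have "d * real n * (B * real n) = e / 2 * real n ^ 2"
      using B by (simp add: d_def power2_eq_square)
    finally have 1: "(\<Sum>i=1..n. (y i)\<^sup>2) \<le> C + e / 2 * real n ^ 2" by simp
    have "2 * C / e < real n" using N' n by linarith
    then have "C < e / 2 * real n" using e by (simp add: field_simps)
    also have "\<dots> \<le> e / 2 * real n ^ 2" using n e by (simp add: power2_eq_square)
    finally have "(\<Sum>i=1..n. (y i)\<^sup>2) < e * real n ^ 2" using 1 by simp
    moreover have "real n ^ 2 > 0" using n by simp
    ultimately have "(\<Sum>i=1..n. (y i)\<^sup>2) / real n ^ 2 < e" by (simp add: divide_less_eq)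
    moreover have "(\<Sum>i=1..n. (y i)\<^sup>2) / real n ^ 2 \<ge> 0" by (intro divide_nonneg_nonneg sum_nonneg) auto
    ultimately show "norm ((\<Sum>i=1..n. (y i)\<^sup>2) / real n ^ 2 - 0) < e" by simp
  qed
qed

section \<open>Means of elementary symmetric functions\<close>
definition esym :: "(nat \<Rightarrow> 'a::comm_ring_1) \<Rightarrow> nat \<Rightarrow> nat \<Rightarrow> 'a" where
  "esym y k n = (\<Sum>L | L \<subseteq> {1..n} \<and> card L = k. \<Prod>l\<in>L. y l)"

lemma esym_0 [simp]: "esym y 0 n = 1"
proof -
  have "{L. L \<subseteq> {1..n} \<and> card L = 0} = {{}}"
    by (auto dest: finite_subset)
  then show ?thesis by (simp add: esym_def)
qed

lemma esym_Suc_0 [simp]: "esym y (Suc k) 0 = 0"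
proof -
  have "{L. L \<subseteq> {1..0::nat} \<and> card L = Suc k} = {}" by auto
  then show ?thesis unfolding esym_def by (metis sum.empty)
qed

text \<open>A \<open>(k+1)\<close>-subset of \<open>{1..n+1}\<close> either avoids \<open>n + 1\<close> or arises from a \<open>k\<close>-subset of \<open>{1..n}\<close> by adding
it.\<close>
lemma esym_Suc_Suc:
  "esym y (Suc k) (Suc n) = esym y (Suc k) n + y (Suc n) * esym y k n"
proof -
  let ?A = "{L. L \<subseteq> {1..n} \<and> card L = Suc k}"
  let ?B = "{L. L \<subseteq> {1..n} \<and> card L = k}"
  have fin: "finite ?A" "finite ?B" by (auto intro: finite_subset[of _ "Pow {1..n}"])
  have split: "{L. L \<subseteq> {1..Suc n} \<and> card L = Suc k} = ?A \<union> insert (Suc n) ` ?B" (is "?L = ?R")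
  proof (intro equalityI subsetI)
    fix L assume L: "L \<in> ?L"
    then have finL: "finite L" using finite_subset by blast
    show "L \<in> ?R"
    proof (cases "Suc n \<in> L")
      case True
      then have "L = insert (Suc n) (L - {Suc n})" by auto
      moreover have "L - {Suc n} \<in> ?B" using L True finL by (auto simp: atLeastAtMostSuc_conv)
      ultimately show ?thesis by blast
    next
      case False then show ?thesis using L by (auto simp: atLeastAtMostSuc_conv)
    qed
  next
    fix L assume "L \<in> ?R"
    then show "L \<in> ?L"
    proof
      assume "L \<in> ?A" then show ?thesis by auto
    next
      assume "L \<in> insert (Suc n) ` ?B"
      then obtain K where K: "L = insert (Suc n) K" "K \<subseteq> {1..n}" "card K = k" by auto
      then have "finite K" "Suc n \<notin> K" using finite_subset by fastforce+
      then show ?thesis using K by auto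
    qed
  qed
  have inj: "inj_on (insert (Suc n)) ?B"
  proof (rule inj_onI)
    fix K K' assume "K \<in> ?B" "K' \<in> ?B" and eq: "insert (Suc n) K = insert (Suc n) K'"
    then have "Suc n \<notin> K" "Suc n \<notin> K'" by auto
    with eq show "K = K'" by (simp add: insert_ident)
  qed
  have "esym y (Suc k) (Suc n) = (\<Sum>L\<in>?A. \<Prod>l\<in>L. y l) + (\<Sum>L\<in>insert (Suc n) ` ?B. \<Prod>l\<in>L. y l)"
    unfolding esym_def split using fin by (intro sum.union_disjoint) auto
  also have "(\<Sum>L\<in>insert (Suc n) ` ?B. \<Prod>l\<in>L. y l) = (\<Sum>K\<in>?B. \<Prod>l\<in>insert (Suc n) K. y l)"
    by (rule sum.reindex[OF inj, unfolded o_def])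
  also have "\<dots> = (\<Sum>K\<in>?B. y (Suc n) * (\<Prod>l\<in>K. y l))"
  proof (rule sum.cong)
    fix K assume "K \<in> ?B"
    then have "finite K" "Suc n \<notin> K" using finite_subset by fastforce+
    then show "(\<Prod>l\<in>insert (Suc n) K. y l) = y (Suc n) * (\<Prod>l\<in>K. y l)" by simp
  qed simp
  finally show ?thesis by (simp add: esym_def sum_distrib_left)
qed

lemma esym_one: "esym (\<lambda>_. 1) k n = of_nat (n choose k)"
  using n_subsets[of "{1..n}" k] by (simp add: esym_def)

lemma norm_esym_le:
  fixes y :: "nat \<Rightarrow> 'a::{real_normed_field}"
  shows "norm (esym y k n) \<le> (\<Sum>i=1..n. norm (y i)) ^ k"
proof (induction n arbitrary: k)
  case 0 then show ?case by (cases k) auto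
next
  case (Suc n)
  show ?case
  proof (cases k)
    case 0 then show ?thesis by simp
  next
    case (Suc k')
    let ?S = "\<Sum>i=1..n. norm (y i)" and ?u = "norm (y (Suc n))"
    have S: "?S \<ge> 0" by (intro sum_nonneg) auto
    have "norm (esym y k (Suc n)) \<le> norm (esym y (Suc k') n) + ?u * norm (esym y k' n)"
      unfolding Suc esym_Suc_Suc norm_mult[symmetric] by (rule norm_triangle_ineq)
    also have "\<dots> \<le> ?S ^ Suc k' + ?u * ?S ^ k'"
      by (intro add_mono mult_left_mono Suc.IH) auto
    also have "\<dots> = (?S + ?u) * ?S ^ k'" by (simp add: algebra_simps)
    also have "\<dots> \<le> (?S + ?u) * (?S + ?u) ^ k'"
      using S by (intro mult_left_mono power_mono) auto
    finally show ?thesis using Suc by simp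
  qed
qed

text \<open>Multiplying the \<open>k\<close>-th elementary symmetric function by the first power sum produces every
\<open>(k+1)\<close>-subset \<open>k + 1\<close> times, plus terms in which one index is repeated. These repeated terms contain a
factor \<open>(y i)\<^sup>2\<close>, which is why the defect is bounded by the sum of squares. Writing \<open>d k n\<close> for the
defect, the proof is the recursion
\<open>d (k+1) (n+1) = d (k+1) n + (y (n+1))\<^sup>2 * esym y k n + y (n+1) * d k n\<close>, so no index sets with
repetitions have to be handled.\<close>
lemma Newton_defect_bound:
  fixes y :: "nat \<Rightarrow> 'a::{real_normed_field}"
  shows "norm ((\<Sum>i=1..n. y i) * esym y (Suc k) n - of_nat (Suc (Suc k)) * esym y (Suc (Suc k)) n)
         \<le> (\<Sum>i=1..n. (norm (y i))\<^sup>2) * (\<Sum>i=1..n. norm (y i)) ^ k"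
proof (induction n arbitrary: k)
  case 0 then show ?case by simp
next
  case (Suc n)
  let ?d = "\<lambda>k n. (\<Sum>i=1..n. y i) * esym y k n - of_nat (Suc k) * esym y (Suc k) n"
  let ?S = "\<Sum>i=1..n. norm (y i)" and ?P = "\<Sum>i=1..n. (norm (y i))\<^sup>2" and ?u = "norm (y (Suc n))"
  have S: "?S \<ge> 0" and P: "?P \<ge> 0" by (auto intro: sum_nonneg)
  have rec: "?d (Suc k) (Suc n) = ?d (Suc k) n + (y (Suc n))\<^sup>2 * esym y k n + y (Suc n) * ?d k n" for k
    by (simp add: esym_Suc_Suc algebra_simps power2_eq_square)
  have d0: "?d 0 n = 0"
    by (induction n) (auto simp: esym_Suc_Suc)
  have dk: "?u * norm (?d k n) + ?P * ?S ^ k \<le> ?P * (?S + ?u) ^ k"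
  proof (cases k)
    case 0 then show ?thesis using d0 by simp
  next
    case (Suc k')
    have "?u * norm (?d k n) + ?P * ?S ^ k \<le> ?u * (?P * ?S ^ k') + ?P * ?S ^ k"
      unfolding Suc by (intro add_right_mono mult_left_mono Suc.IH) auto
    also have "\<dots> = ?P * ((?S + ?u) * ?S ^ k')" using Suc by (simp add: algebra_simps)
    also have "\<dots> \<le> ?P * ((?S + ?u) * (?S + ?u) ^ k')"
      using S P by (intro mult_left_mono power_mono) auto
    finally show ?thesis using Suc by simp
  qed
  have "norm (?d (Suc k) (Suc n)) \<le> norm (?d (Suc k) n) + norm ((y (Suc n))\<^sup>2 * esym y k n) + norm (y (Suc n) * ?d k n)"
    unfolding rec by (intro norm_triangle_le add_right_mono norm_triangle_ineq)
  also have "\<dots> \<le> ?P * ?S ^ k + ?u\<^sup>2 * ?S ^ k + ?u * norm (?d k n)"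
    unfolding norm_mult norm_power
    by (intro add_mono Suc.IH mult_left_mono norm_esym_le) auto
  also have "\<dots> \<le> ?P * (?S + ?u) ^ k + ?u\<^sup>2 * (?S + ?u) ^ k"
    using dk S by (intro order_trans[OF _ add_mono[OF dk mult_left_mono[OF power_mono]]]) auto
  finally show ?case by (simp add: algebra_simps)
qed

text \<open>Up to the defect, which is of order \<open>o(n ^ (k + 1))\<close> by \<open>sum_squares_negligible\<close>, passing from \<open>k\<close> to \<open>k + 1\<close>
multiplies by the average of \<open>y\<close> and divides by \<open>k + 1\<close>.\<close>
lemma esym_over_power_tendsto:
  fixes y :: "nat \<Rightarrow> 'a::{real_normed_field}"
  assumes avg: "(\<lambda>n. (\<Sum>i=1..n. y i) / of_nat n) \<longlonglongrightarrow> \<mu>"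
    and abs_avg: "(\<lambda>n. (\<Sum>i=1..n. norm (y i)) / real n) \<longlonglongrightarrow> c"
  shows "(\<lambda>n. esym y k n / of_nat n ^ k) \<longlonglongrightarrow> \<mu> ^ k / fact k"
proof (induction k)
  case 0 then show ?case by simp
next
  case (Suc k)
  let ?d = "\<lambda>k n. (\<Sum>i=1..n. y i) * esym y k n - of_nat (Suc k) * esym y (Suc k) n"
  have d: "(\<lambda>n. ?d k n / of_nat n ^ Suc k) \<longlonglongrightarrow> 0"
  proof (cases k)
    case 0
    have "?d 0 n = 0" for n by (induction n) (auto simp: esym_Suc_Suc)
    then show ?thesis using 0 by simp
  next
    case k: (Suc k')
    have "(\<lambda>n. ((\<Sum>i=1..n. (norm (y i))\<^sup>2) / real n ^ 2) * ((\<Sum>i=1..n. norm (y i)) / real n) ^ k')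
        \<longlonglongrightarrow> 0 * c ^ k'"
      by (intro tendsto_mult tendsto_power abs_avg sum_squares_negligible[OF _ abs_avg]) auto
    then have lim: "(\<lambda>n. ((\<Sum>i=1..n. (norm (y i))\<^sup>2) * (\<Sum>i=1..n. norm (y i)) ^ k') / real n ^ Suc k) \<longlonglongrightarrow> 0"
      using k by (simp add: power_divide power2_eq_square mult.assoc)
    show ?thesis
    proof (rule Lim_null_comparison[OF _ lim], rule always_eventually, rule allI)
      fix n
      show "norm (?d k n / of_nat n ^ Suc k) \<le> ((\<Sum>i=1..n. (norm (y i))\<^sup>2) * (\<Sum>i=1..n. norm (y i)) ^ k') / real n ^ Suc k"
        unfolding norm_divide norm_power norm_of_nat
        unfolding k by (intro divide_right_mono Newton_defect_bound) auto
    qed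
  qed
  have "(\<lambda>n. (((\<Sum>i=1..n. y i) / of_nat n) * (esym y k n / of_nat n ^ k) - ?d k n / of_nat n ^ Suc k) / of_nat (Suc k))
      \<longlonglongrightarrow> (\<mu> * (\<mu> ^ k / fact k) - 0) / of_nat (Suc k)"
    by (intro tendsto_divide tendsto_diff tendsto_mult avg Suc d tendsto_const) (simp del: of_nat_Suc)
  moreover have "(((\<Sum>i=1..n. y i) / of_nat n) * (esym y k n / of_nat n ^ k) - ?d k n / of_nat n ^ Suc k) / of_nat (Suc k)
      = esym y (Suc k) n / of_nat n ^ Suc k" for n
  proof -
    have "((\<Sum>i=1..n. y i) / of_nat n) * (esym y k n / of_nat n ^ k) - ?d k n / of_nat n ^ Suc k
       = of_nat (Suc k) * esym y (Suc k) n / of_nat n ^ Suc k"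
      by (simp add: diff_divide_distrib del: of_nat_Suc)
    then show ?thesis by (simp del: of_nat_Suc)
  qed
  ultimately have "(\<lambda>n. esym y (Suc k) n / of_nat n ^ Suc k) \<longlonglongrightarrow> (\<mu> * (\<mu> ^ k / fact k) - 0) / of_nat (Suc k)"
    by (simp only:)
  then show ?case by (simp add: mult.commute)
qed

lemma esym_mean_tendsto:
  fixes y :: "nat \<Rightarrow> 'a::{real_normed_field}"
  assumes avg: "(\<lambda>n. (\<Sum>i=1..n. y i) / of_nat n) \<longlonglongrightarrow> \<mu>"
    and abs_avg: "(\<lambda>n. (\<Sum>i=1..n. norm (y i)) / real n) \<longlonglongrightarrow> c"
  shows "(\<lambda>n. esym y k n / of_nat (n choose k)) \<longlonglongrightarrow> \<mu> ^ k"
proof -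
  have one: "(\<lambda>n. (of_nat n :: 'b::real_normed_field) / of_nat n) \<longlonglongrightarrow> 1"
    by (rule tendsto_eventually) (auto simp: eventually_sequentially intro!: exI[of _ 1])
  \<comment> \<open>The constant sequence 1 gives the asymptotics of the binomial coefficient.\<close>
  have "(\<lambda>n. esym (\<lambda>_. 1::'a) k n / of_nat n ^ k) \<longlonglongrightarrow> 1 ^ k / fact k"
    by (rule esym_over_power_tendsto[where c = 1]) (use one in auto)
  then have binom: "(\<lambda>n. (of_nat (n choose k) :: 'a) / of_nat n ^ k) \<longlonglongrightarrow> 1 / fact k"
    by (simp add: esym_one)
  have "(\<lambda>n. (esym y k n / of_nat n ^ k) / (of_nat (n choose k) / of_nat n ^ k)) \<longlonglongrightarrow> (\<mu> ^ k / fact k) / (1 / fact k)"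
    by (intro tendsto_divide esym_over_power_tendsto[OF avg abs_avg] binom) auto
  then have "(\<lambda>n. (esym y k n / of_nat n ^ k) / (of_nat (n choose k) / of_nat n ^ k)) \<longlonglongrightarrow> \<mu> ^ k" by simp
  then show ?thesis
    by (rule Lim_transform_eventually) (auto simp: eventually_sequentially intro!: exI[of _ 1])
qed

section \<open>A strong law of large numbers\<close>

text \<open>A form of the Borel-Cantelli lemma that needs neither events nor thresholds: the sum of the \<open>w j\<close> has
finite expectation, hence is finite almost everywhere, hence its terms vanish. It serves twice in the
strong law, once for the variances and once for the truncation.\<close>
lemma AE_tendsto_0_of_summable_integrals:
  fixes w :: "nat \<Rightarrow> 'a \<Rightarrow> real"
  assumes int: "\<And>j. integrable M (w j)" and nonneg: "\<And>j x. 0 \<le> w j x"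
    and sm: "summable (\<lambda>j. integral\<^sup>L M (w j))"
  shows "AE x in M. (\<lambda>j. w j x) \<longlonglongrightarrow> 0"
proof -
  have "(\<integral>\<^sup>+ x. (\<Sum>j. ennreal (w j x)) \<partial>M) = (\<Sum>j. \<integral>\<^sup>+ x. ennreal (w j x) \<partial>M)"
    using int by (intro nn_integral_suminf) auto
  also have "\<dots> = (\<Sum>j. ennreal (integral\<^sup>L M (w j)))"
    using int nonneg by (intro suminf_cong nn_integral_eq_integral) auto
  also have "\<dots> \<noteq> \<infinity>"
    using sm nonneg by (subst suminf_ennreal2) auto
  finally have "AE x in M. (\<Sum>j. ennreal (w j x)) \<noteq> \<infinity>"
    using int by (intro nn_integral_PInf_AE) auto
  then show ?thesis
  proof eventually_elim
    case (elim x)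
    then have "summable (\<lambda>j. w j x)"
      using nonneg by (intro summable_suminf_not_top) auto
    then show ?case by (rule summable_LIMSEQ_zero)
  qed
qed

lemma integrable_identically_distributed:
  fixes g :: "'b::topological_space \<Rightarrow> 'c::{banach, second_countable_topology}"
  assumes "distr M borel Y = distr M borel Z" "Y \<in> borel_measurable M" "Z \<in> borel_measurable M"
    and g: "g \<in> borel_measurable borel"
  shows "integrable M (\<lambda>x. g (Y x)) \<longleftrightarrow> integrable M (\<lambda>x. g (Z x))"
  using integrable_distr_eq[OF assms(2), of g] integrable_distr_eq[OF assms(3), of g] g assms(1) by simp

lemma integral_identically_distributed:
  fixes g :: "'b::topological_space \<Rightarrow> 'c::{banach, second_countable_topology}"
  assumes "distr M borel Y = distr M borel Z" "Y \<in> borel_measurable M" "Z \<in> borel_measurable M"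
    and g: "g \<in> borel_measurable borel"
  shows "(\<integral>x. g (Y x) \<partial>M) = (\<integral>x. g (Z x) \<partial>M)"
  using integral_distr[OF assms(2), of g] integral_distr[OF assms(3), of g] g assms(1) by simp

lemma nn_integral_identically_distributed:
  fixes g :: "'b::topological_space \<Rightarrow> ennreal"
  assumes "distr M borel Y = distr M borel Z" "Y \<in> borel_measurable M" "Z \<in> borel_measurable M"
    and g: "g \<in> borel_measurable borel"
  shows "(\<integral>\<^sup>+x. g (Y x) \<partial>M) = (\<integral>\<^sup>+x. g (Z x) \<partial>M)"
  using nn_integral_distr[OF assms(2), of g] nn_integral_distr[OF assms(3), of g] g assms(1) by simp

lemma (in prob_space) expectation_sum_squared_centered:
  fixes W :: "nat \<Rightarrow> 'a \<Rightarrow> real"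
  assumes I: "finite I" and indep: "indep_vars (\<lambda>_. borel) W I"
    and sq: "\<And>i. i \<in> I \<Longrightarrow> integrable M (\<lambda>x. (W i x)\<^sup>2)"
    and centered: "\<And>i. i \<in> I \<Longrightarrow> expectation (W i) = 0"
  shows "integrable M (\<lambda>x. (\<Sum>i\<in>I. W i x)\<^sup>2)"
    and "expectation (\<lambda>x. (\<Sum>i\<in>I. W i x)\<^sup>2) = (\<Sum>i\<in>I. expectation (\<lambda>x. (W i x)\<^sup>2))"
proof -
  have rv: "i \<in> I \<Longrightarrow> W i \<in> borel_measurable M" for i
    using indep by (auto simp: indep_vars_def)
  have int: "i \<in> I \<Longrightarrow> integrable M (W i)" for i
    using square_integrable_imp_integrable[OF rv sq] by blast
  have pair: "integrable M (\<lambda>x. W i x * W j x) \<and>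
      expectation (\<lambda>x. W i x * W j x) = (if i = j then expectation (\<lambda>x. (W i x)\<^sup>2) else 0)"
    if ij: "i \<in> I" "j \<in> I" for i j
  proof (cases "i = j")
    case True then show ?thesis using sq[OF ij(1)] by (simp add: power2_eq_square)
  next
    case False
    have ind: "indep_vars (\<lambda>_. borel) W {i, j}"
      by (rule indep_vars_subset[OF indep]) (use ij in auto)
    have "integrable M (\<lambda>x. \<Prod>l\<in>{i, j}. W l x)"
      by (rule indep_vars_integrable[OF _ ind]) (use ij int in auto)
    moreover have "expectation (\<lambda>x. \<Prod>l\<in>{i, j}. W l x) = (\<Prod>l\<in>{i, j}. expectation (W l))"
      by (rule indep_vars_lebesgue_integral[OF _ ind]) (use ij int in auto)
    ultimately show ?thesis using False centered ij by simp
  qed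
  have pair_int: "integrable M (\<lambda>x. W i x * W j x)" if "i \<in> I" "j \<in> I" for i j
    using pair[OF that] by simp
  have eq: "(\<Sum>i\<in>I. W i x)\<^sup>2 = (\<Sum>i\<in>I. \<Sum>j\<in>I. W i x * W j x)" for x
    by (simp add: power2_eq_square sum_product)
  show "integrable M (\<lambda>x. (\<Sum>i\<in>I. W i x)\<^sup>2)"
    unfolding eq by (intro Bochner_Integration.integrable_sum pair_int)
  have "expectation (\<lambda>x. (\<Sum>i\<in>I. W i x)\<^sup>2) = (\<Sum>i\<in>I. \<Sum>j\<in>I. expectation (\<lambda>x. W i x * W j x))"
    unfolding eq
    by (subst Bochner_Integration.integral_sum, intro Bochner_Integration.integrable_sum pair_int, assumption+)
      (intro sum.cong refl Bochner_Integration.integral_sum pair_int)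
  also have "\<dots> = (\<Sum>i\<in>I. \<Sum>j\<in>I. if i = j then expectation (\<lambda>x. (W i x)\<^sup>2) else 0)"
    by (intro sum.cong refl) (simp add: pair)
  also have "\<dots> = (\<Sum>i\<in>I. expectation (\<lambda>x. (W i x)\<^sup>2))"
    using I by simp
  finally show "expectation (\<lambda>x. (\<Sum>i\<in>I. W i x)\<^sup>2) = (\<Sum>i\<in>I. expectation (\<lambda>x. (W i x)\<^sup>2))" .
qed

lemma powr_le_one_plus_powr:
  fixes x :: real
  assumes "0 \<le> x" "0 \<le> a" "a \<le> b"
  shows "x powr a \<le> 1 + x powr b"
proof (cases "x \<le> 1")
  case True
  then have "x powr a \<le> 1" using assms powr_mono2[of a x 1] by simp
  then show ?thesis by (simp add: add_increasing2)
next
  case False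
  then have "x powr a \<le> x powr b" using assms by (intro powr_mono) auto
  then show ?thesis by simp
qed

text \<open>Etemadi's method, simplified by the availability of a moment of order \<open>p > 1\<close>. The variable \<open>Y i\<close> is
truncated at level \<open>i\<close>. Its truncation \<open>Z i\<close> has second moment at most \<open>B * i powr (2 - p)\<close>, so the
average of the first \<open>n\<close> centered truncations has variance at most \<open>B * n powr (1 - p)\<close>, which is summable
along \<open>n = j ^ r\<close> as soon as \<open>r * (p - 1) > 1\<close>. The means of the truncations converge, the truncation
changes only finitely many terms almost surely, and nonnegativity allows interpolation between the
indices \<open>j ^ r\<close>.\<close>
lemma (in prob_space) strong_law_nonneg:
  fixes Y :: "nat \<Rightarrow> 'a \<Rightarrow> real"
  assumes indep: "indep_vars (\<lambda>_. borel) Y {1..}"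
    and ident: "\<And>i. i \<ge> 1 \<Longrightarrow> distr M borel (Y i) = distr M borel (Y 1)"
    and nonneg: "\<And>i x. 0 \<le> Y i x"
    and p: "1 < p" "p \<le> 2" and mom: "integrable M (\<lambda>x. Y 1 x powr p)"
  shows "AE x in M. (\<lambda>n. (\<Sum>i=1..n. Y i x) / real n) \<longlonglongrightarrow> expectation (Y 1)"
proof -
  have rv: "i \<ge> 1 \<Longrightarrow> Y i \<in> borel_measurable M" for i
    using indep by (auto simp: indep_vars_def)
  have rv1 [measurable]: "Y 1 \<in> borel_measurable M" by (rule rv) simp
  have Y1: "integrable M (Y 1)"
  proof (rule Bochner_Integration.integrable_bound[OF Bochner_Integration.integrable_add[OF integrable_const[of 1] mom]])
    show "AE x in M. norm (Y 1 x) \<le> norm (1 + Y 1 x powr p)"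
    proof (rule AE_I2)
      fix x show "norm (Y 1 x) \<le> norm (1 + Y 1 x powr p)"
        using powr_le_one_plus_powr[of "Y 1 x" 1 p] nonneg[of 1 x] p by simp
    qed
  qed (rule rv1)
  define B where "B = expectation (\<lambda>x. Y 1 x powr p)"
  have momi: "integrable M (\<lambda>x. Y i x powr p)" and EB: "expectation (\<lambda>x. Y i x powr p) = B" if "i \<ge> 1" for i
    using integrable_identically_distributed[OF ident[OF that] rv[OF that] rv1, of "\<lambda>y. y powr p"]
      integral_identically_distributed[OF ident[OF that] rv[OF that] rv1, of "\<lambda>y. y powr p"] mom
    by (auto simp: B_def)
  define h where "h i y = (if y \<le> real i then y else 0)" for i :: nat and y :: real
  have h [measurable]: "h i \<in> borel_measurable borel" for i unfolding h_def by measurable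
  have h0: "0 \<le> y \<Longrightarrow> 0 \<le> h i y" "0 \<le> y \<Longrightarrow> h i y \<le> y" "0 \<le> y \<Longrightarrow> \<bar>h i y\<bar> \<le> real i" for i y
    by (auto simp: h_def)
  have hsq: "(h i y)\<^sup>2 \<le> real i powr (2 - p) * y powr p" if "0 \<le> y" for i y
  proof (cases "0 < y \<and> y \<le> real i")
    case True
    have "(h i y)\<^sup>2 = y powr (2 - p) * y powr p"
      using True by (simp add: h_def flip: powr_add)
    also have "\<dots> \<le> real i powr (2 - p) * y powr p"
      using True p by (intro mult_right_mono powr_mono2) auto
    finally show ?thesis .
  next
    case False
    then have "h i y = 0" using that by (auto simp: h_def)
    then show ?thesis by simp
  qed
  define Z where "Z i x = h i (Y i x)" for i x
  have Zrv: "Z i \<in> borel_measurable M" if "i \<ge> 1" for i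
    unfolding Z_def[abs_def] using rv[OF that] by measurable
  have Zint: "integrable M (Z i)" and Zsq: "integrable M (\<lambda>x. (Z i x)\<^sup>2)" if "i \<ge> 1" for i
  proof -
    show "integrable M (Z i)"
      using h0(3)[OF nonneg] Zrv[OF that] by (intro integrable_const_bound[where B = "real i"]) (auto simp: Z_def)
    have "(Z i x)\<^sup>2 \<le> (real i)\<^sup>2" for x
      unfolding Z_def by (rule power2_le_iff_abs_le[THEN iffD2]) (auto intro: h0(3) nonneg)
    then show "integrable M (\<lambda>x. (Z i x)\<^sup>2)"
      using Zrv[OF that] by (intro integrable_const_bound[where B = "(real i)\<^sup>2"]) auto
  qed
  define e where "e i = expectation (Z i)" for i
  define W where "W i x = Z i x - e i" for i x
  have Wsq: "integrable M (\<lambda>x. (W i x)\<^sup>2)" if "i \<ge> 1" for i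
    using Zsq[OF that] Zint[OF that] by (simp add: W_def power2_diff)
  have Wmean: "expectation (W i) = 0" if "i \<ge> 1" for i
    using Zint[OF that] by (simp add: W_def[abs_def] e_def prob_space)
  have Windep: "indep_vars (\<lambda>_. borel) W {1..}"
    unfolding W_def[abs_def] Z_def[abs_def]
    by (rule indep_vars_compose2[OF indep, where Y = "\<lambda>i y. h i y - e i"]) measurable
  have B0: "B \<ge> 0" unfolding B_def by (intro integral_nonneg_AE) simp
  have EW: "expectation (\<lambda>x. (W i x)\<^sup>2) \<le> B * real i powr (2 - p)" if "i \<ge> 1" for i
  proof -
    have "expectation (\<lambda>x. (W i x)\<^sup>2) = expectation (\<lambda>x. (Z i x)\<^sup>2) - (e i)\<^sup>2"
      unfolding W_def e_def using Zint[OF that] Zsq[OF that] by (rule variance_eq)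
    also have "\<dots> \<le> expectation (\<lambda>x. (Z i x)\<^sup>2)" by simp
    also have "\<dots> \<le> expectation (\<lambda>x. real i powr (2 - p) * Y i x powr p)"
      using Zsq[OF that] momi[OF that] by (intro integral_mono) (auto simp: Z_def intro: hsq nonneg)
    also have "\<dots> = B * real i powr (2 - p)" using EB[OF that] by simp
    finally show ?thesis .
  qed
  have var: "integrable M (\<lambda>x. (\<Sum>i=1..n. W i x)\<^sup>2)"
     "expectation (\<lambda>x. (\<Sum>i=1..n. W i x)\<^sup>2) \<le> B * real n powr (3 - p)" for n
  proof -
    have ind: "indep_vars (\<lambda>_. borel) W {1..n}" by (rule indep_vars_subset[OF Windep]) auto
    show "integrable M (\<lambda>x. (\<Sum>i=1..n. W i x)\<^sup>2)"
      by (rule expectation_sum_squared_centered[OF _ ind]) (auto intro: Wsq Wmean)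
    have "expectation (\<lambda>x. (\<Sum>i=1..n. W i x)\<^sup>2) = (\<Sum>i=1..n. expectation (\<lambda>x. (W i x)\<^sup>2))"
      by (rule expectation_sum_squared_centered[OF _ ind]) (auto intro: Wsq Wmean)
    also have "\<dots> \<le> (\<Sum>i=1..n. B * real n powr (2 - p))"
    proof (rule sum_mono)
      fix i assume i: "i \<in> {1..n}"
      have "expectation (\<lambda>x. (W i x)\<^sup>2) \<le> B * real i powr (2 - p)" using i by (intro EW) simp
      also have "\<dots> \<le> B * real n powr (2 - p)"
        using i p B0 by (intro mult_left_mono powr_mono2) auto
      finally show "expectation (\<lambda>x. (W i x)\<^sup>2) \<le> B * real n powr (2 - p)" .
    qed
    also have "\<dots> = B * (real n powr 1 * real n powr (2 - p))" by simp
    also have "real n powr 1 * real n powr (2 - p) = real n powr (3 - p)"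
      unfolding powr_add[symmetric] by simp
    finally show "expectation (\<lambda>x. (\<Sum>i=1..n. W i x)\<^sup>2) \<le> B * real n powr (3 - p)" .
  qed
  \<comment> \<open>This choice of the exponent makes the variances summable along the r-th powers.\<close>
  obtain r :: nat where r0: "real r > 1 / (p - 1)" using reals_Archimedean2 by blast
  then have r1: "r > 0" using p by (cases r) auto
  have r: "real r * (p - 1) > 1" using r0 p by (simp add: field_simps)
  define k where "k j = Suc j ^ r" for j
  have k0: "real (k j) > 0" for j by (simp add: k_def)
  have "AE x in M. (\<lambda>j. ((\<Sum>i=1..k j. W i x) / real (k j))\<^sup>2) \<longlonglongrightarrow> 0"
  proof (rule AE_tendsto_0_of_summable_integrals)
    show "integrable M (\<lambda>x. ((\<Sum>i=1..k j. W i x) / real (k j))\<^sup>2)" for j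
      using var(1)[of "k j"] by (simp add: power_divide)
    have bound: "expectation (\<lambda>x. ((\<Sum>i=1..k j. W i x) / real (k j))\<^sup>2) \<le> B * real (Suc j) powr (real r * (1 - p))" for j
    proof -
      have "expectation (\<lambda>x. ((\<Sum>i=1..k j. W i x) / real (k j))\<^sup>2) = expectation (\<lambda>x. (\<Sum>i=1..k j. W i x)\<^sup>2) / (real (k j))\<^sup>2"
        by (simp add: power_divide)
      also have "\<dots> \<le> B * real (k j) powr (3 - p) / (real (k j))\<^sup>2"
        by (intro divide_right_mono var) simp
      also have "\<dots> = B * (real (k j) powr (3 - p) / real (k j) powr 2)"
        using k0[of j] by simp
      also have "\<dots> = B * real (k j) powr (1 - p)"
        by (subst powr_diff[symmetric]) simp
      also have "real (k j) powr (1 - p) = real (Suc j) powr (real r * (1 - p))"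
        unfolding powr_powr[symmetric] k_def by (simp add: powr_realpow)
      finally show ?thesis .
    qed
    have "summable (\<lambda>j. B * real (Suc j) powr (real r * (1 - p)))"
    proof (intro summable_mult)
      have "summable (\<lambda>j. real j powr (real r * (1 - p)))"
        using r by (subst summable_real_powr_iff) (simp add: algebra_simps)
      then show "summable (\<lambda>j. real (Suc j) powr (real r * (1 - p)))"
        by (subst summable_Suc_iff)
    qed
    then show "summable (\<lambda>j. expectation (\<lambda>x. ((\<Sum>i=1..k j. W i x) / real (k j))\<^sup>2))"
      by (rule summable_comparison_test') (use bound in auto)
  qed simp
  \<comment> \<open>Since p exceeds 1 this is summable, so Y i / i tends to 0 and the truncation is eventually void.\<close>
  moreover have "AE x in M. (\<lambda>j. Y (Suc j) x powr p / real (Suc j) powr p) \<longlonglongrightarrow> 0"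
  proof (rule AE_tendsto_0_of_summable_integrals)
    show "integrable M (\<lambda>x. Y (Suc j) x powr p / real (Suc j) powr p)" for j
      by (intro integrable_divide momi) simp
    have "summable (\<lambda>j. real j powr (- p))" using p by (subst summable_real_powr_iff) simp
    then have "summable (\<lambda>j. B * real (Suc j) powr (- p))"
      by (intro summable_mult) (subst summable_Suc_iff)
    then show "summable (\<lambda>j. expectation (\<lambda>x. Y (Suc j) x powr p / real (Suc j) powr p))"
      using EB[of "Suc j" for j] by (simp add: powr_minus divide_inverse)
  qed simp
  ultimately show ?thesis
  proof eventually_elim
    case (elim x)
    have e: "e \<longlonglongrightarrow> expectation (Y 1)"
    proof -
      have "(\<lambda>i. expectation (\<lambda>x. h i (Y 1 x))) \<longlonglongrightarrow> expectation (Y 1)"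
      proof (rule integral_dominated_convergence[where w = "Y 1"])
        show "AE x in M. (\<lambda>i. h i (Y 1 x)) \<longlonglongrightarrow> Y 1 x"
        proof (rule AE_I2, rule tendsto_eventually)
          fix x
          obtain N where "Y 1 x \<le> real N" using real_arch_simple by blast
          then show "eventually (\<lambda>i. h i (Y 1 x) = Y 1 x) sequentially"
            unfolding eventually_sequentially h_def by (intro exI[of _ N]) auto
        qed
        show "AE x in M. norm (h i (Y 1 x)) \<le> Y 1 x" for i
          using h0 nonneg by auto
      qed (use Y1 in auto)
      moreover have "eventually (\<lambda>i. expectation (\<lambda>x. h i (Y 1 x)) = e i) sequentially"
        unfolding eventually_sequentially
      proof (intro exI allI impI)
        fix i :: nat assume "i \<ge> 1"
        then show "expectation (\<lambda>x. h i (Y 1 x)) = e i"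
          unfolding e_def Z_def
          by (intro integral_identically_distributed[OF ident rv rv1 h, symmetric]) auto
      qed
      ultimately show ?thesis by (rule Lim_transform_eventually)
    qed
    have "(\<lambda>j. \<bar>(\<Sum>i=1..k j. W i x) / real (k j)\<bar>) \<longlonglongrightarrow> 0"
      using tendsto_real_sqrt[OF elim(1)] by simp
    then have W: "(\<lambda>j. (\<Sum>i=1..k j. W i x) / real (k j)) \<longlonglongrightarrow> 0"
      by (rule tendsto_rabs_zero_cancel)
    have D: "(\<lambda>i. Y i x - Z i x) \<longlonglongrightarrow> 0"
    proof (rule LIMSEQ_imp_Suc, rule tendsto_eventually)
      have "eventually (\<lambda>j. Y (Suc j) x powr p / real (Suc j) powr p < 1) sequentially"
        using order_tendstoD(2)[OF elim(2), of 1] by simp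
      then show "eventually (\<lambda>j. Y (Suc j) x - Z (Suc j) x = 0) sequentially"
      proof eventually_elim
        case (elim j)
        then have "Y (Suc j) x powr p < real (Suc j) powr p" by simp
        then have "Y (Suc j) x < real (Suc j)"
          using p powr_mono2[of p "real (Suc j)" "Y (Suc j) x"] by (force simp: not_less[symmetric])
        then show ?case by (simp add: Z_def h_def)
      qed
    qed
    have avg: "(\<lambda>n. (\<Sum>i=1..n. Y i x - Z i x) / real n + (\<Sum>i=1..n. e i) / real n) \<longlonglongrightarrow> 0 + expectation (Y 1)"
      by (intro tendsto_add Cesaro_mean_tendsto D e)
    have ktop: "filterlim k at_top sequentially"
    proof (rule filterlim_at_top_mono[OF filterlim_Suc])
      show "eventually (\<lambda>j. Suc j \<le> k j) sequentially"
        unfolding k_def by (intro always_eventually allI self_le_power r1) simp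
    qed
    have "(\<lambda>j. (\<Sum>i=1..k j. W i x) / real (k j) + ((\<Sum>i=1..k j. Y i x - Z i x) / real (k j) + (\<Sum>i=1..k j. e i) / real (k j)))
       \<longlonglongrightarrow> 0 + (0 + expectation (Y 1))"
      by (intro tendsto_add W filterlim_compose[OF avg ktop])
    moreover have "(\<Sum>i=1..k j. W i x) / real (k j) + ((\<Sum>i=1..k j. Y i x - Z i x) / real (k j) + (\<Sum>i=1..k j. e i) / real (k j))
       = (\<Sum>i=1..k j. Y i x) / real (k j)" for j
      unfolding add_divide_distrib[symmetric] sum.distrib[symmetric] W_def by simp
    ultimately have "(\<lambda>j. (\<Sum>i=1..Suc j ^ r. Y i x) / real (Suc j ^ r)) \<longlonglongrightarrow> expectation (Y 1)"
      unfolding k_def by (simp only: add_0_left)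
    then have lim: "(\<lambda>j. (\<Sum>i=1..j ^ r. Y i x) / real (j ^ r)) \<longlonglongrightarrow> expectation (Y 1)"
      by (rule LIMSEQ_imp_Suc)
    show ?case
      by (rule average_tendsto_from_powers[OF r1 _ _ lim])
        (auto intro!: monoI sum_mono2 sum_nonneg nonneg)
  qed
qed

section \<open>Symmetric means of independent, identically distributed complex variables\<close>

text \<open>Jensen's inequality below is applied to absolute values, which may vanish, so the origin has to be
included.\<close>
lemma convex_on_powr_nonneg:
  fixes p :: real
  assumes p: "p \<ge> 1"
  shows "convex_on {0..} (\<lambda>x. x powr p)"
proof (rule convex_onI)
  fix t x y :: real assume t: "0 < t" "t < 1" and xy: "x \<in> {0..}" "y \<in> {0..}"
  have le: "u powr p \<le> u" if "0 < u" "u < 1" for u :: real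
    using powr_mono'[of 1 p u] that p by simp
  consider "x = 0" | "y = 0" | "x > 0" "y > 0" using xy by force
  then show "((1 - t) *\<^sub>R x + t *\<^sub>R y) powr p \<le> (1 - t) * x powr p + t * y powr p"
  proof cases
    case 1 then show ?thesis using t xy le[of t] by (simp add: powr_mult mult_right_mono)
  next
    case 2 then show ?thesis using t xy le[of "1 - t"] by (simp add: powr_mult mult_right_mono)
  next
    case 3 then show ?thesis using convex_onD[OF powr_convex[OF p], of t x y] t by simp
  qed
qed simp

lemma norm_mean_powr_le:
  fixes z :: "'i \<Rightarrow> complex"
  assumes S: "finite S" "S \<noteq> {}" and p: "p \<ge> 1"
  shows "cmod ((\<Sum>i\<in>S. z i) / of_nat (card S)) powr p \<le> (\<Sum>i\<in>S. cmod (z i) powr p) / real (card S)"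
proof -
  have N: "real (card S) > 0" using S by (simp add: card_gt_0_iff)
  have "cmod ((\<Sum>i\<in>S. z i) / of_nat (card S)) \<le> (\<Sum>i\<in>S. (1 / real (card S)) *\<^sub>R cmod (z i))"
    using N norm_sum[of z S] by (simp add: norm_divide divide_right_mono flip: sum_divide_distrib)
  then have "cmod ((\<Sum>i\<in>S. z i) / of_nat (card S)) powr p \<le> (\<Sum>i\<in>S. (1 / real (card S)) *\<^sub>R cmod (z i)) powr p"
    using p by (intro powr_mono2) auto
  also have "\<dots> \<le> (\<Sum>i\<in>S. (1 / real (card S)) * cmod (z i) powr p)"
    by (rule convex_on_sum[OF S convex_on_powr_nonneg[OF p]]) (use N in auto)
  finally show ?thesis by (simp flip: sum_divide_distrib)
qed

lemma norm_diff_powr_le: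
  fixes a b :: complex
  assumes p: "p \<ge> 0"
  shows "cmod (a - b) powr p \<le> 2 powr p * (cmod a powr p + cmod b powr p)"
proof -
  have "cmod (a - b) \<le> 2 * max (cmod a) (cmod b)" using norm_triangle_ineq4[of a b] by simp
  then have "cmod (a - b) powr p \<le> (2 * max (cmod a) (cmod b)) powr p" using p by (intro powr_mono2) auto
  also have "\<dots> = 2 powr p * max (cmod a) (cmod b) powr p" by (simp add: powr_mult)
  also have "max (cmod a) (cmod b) powr p \<le> cmod a powr p + cmod b powr p"
    by (simp add: max_def)
  finally show ?thesis by simp
qed

text \<open>A bounded moment of order \<open>p\<close> makes the \<open>q\<close>-th powers uniformly integrable for \<open>q < p\<close>. Concretely, the
part of \<open>D n powr q\<close> where \<open>D n > K\<close> is at most \<open>K powr (q - p) * D n powr p\<close>, small uniformly in \<open>n\<close> for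
large \<open>K\<close>, and dominated convergence handles the truncation at \<open>K\<close>.\<close>
lemma (in finite_measure) moment_tendsto_0_of_AE_of_bounded_moment:
  fixes D :: "nat \<Rightarrow> 'a \<Rightarrow> real"
  assumes meas [measurable]: "\<And>n. D n \<in> borel_measurable M" and nonneg: "\<And>n x. 0 \<le> D n x"
    and ae: "AE x in M. (\<lambda>n. D n x) \<longlonglongrightarrow> 0"
    and q: "0 < q" "q < p"
    and bnd: "\<And>n. n \<ge> N \<Longrightarrow> (\<integral>\<^sup>+x. ennreal (D n x powr p) \<partial>M) \<le> ennreal B"
  shows "(\<lambda>n. \<integral>\<^sup>+x. ennreal (D n x powr q) \<partial>M) \<longlonglongrightarrow> 0"
proof (rule order_tendstoI)
  fix a :: ennreal assume a: "0 < a"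
  obtain e :: real where e: "e > 0" "ennreal e \<le> a"
  proof (cases a)
    case (real r)
    then show ?thesis using a that[of r] by auto
  next
    case top
    then show ?thesis using that[of 1] by simp
  qed
  have "((\<lambda>K. K powr (q - p) * B) \<longlongrightarrow> 0 * B) at_top"
    using q by (intro tendsto_mult tendsto_neg_powr filterlim_ident tendsto_const) auto
  then have "eventually (\<lambda>K. K powr (q - p) * B < e / 2) at_top"
    using e by (intro order_tendstoD(2)[of _ 0]) auto
  then have "eventually (\<lambda>K. K powr (q - p) * B < e / 2 \<and> K > (0::real)) at_top"
    using eventually_gt_at_top[of 0] by eventually_elim auto
  then obtain K where K: "K powr (q - p) * B < e / 2" "K > 0"
    using eventually_happens by force
  have split: "D n x powr q \<le> min (D n x) K powr q + K powr (q - p) * D n x powr p" for n x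
  proof (cases "D n x \<le> K")
    case True then show ?thesis by (simp add: min_def)
  next
    case False
    have "D n x powr q = D n x powr (q - p) * D n x powr p" by (simp flip: powr_add)
    also have "\<dots> \<le> K powr (q - p) * D n x powr p"
      using False K q by (intro mult_right_mono powr_mono2') auto
    finally show ?thesis by (simp add: add_increasing)
  qed
  have "(\<lambda>n. \<integral>\<^sup>+x. ennreal (min (D n x) K powr q) \<partial>M) \<longlonglongrightarrow> (\<integral>\<^sup>+x. 0 \<partial>M)"
  proof (rule nn_integral_dominated_convergence[where w = "\<lambda>_. ennreal (K powr q)"])
    show "AE x in M. ennreal (min (D n x) K powr q) \<le> ennreal (K powr q)" for n
      using nonneg K q by (intro AE_I2 ennreal_leI powr_mono2) auto
    show "(\<integral>\<^sup>+x. ennreal (K powr q) \<partial>M) < \<infinity>"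
      by (simp add: ennreal_mult_eq_top_iff less_top[symmetric])
    show "AE x in M. (\<lambda>n. ennreal (min (D n x) K powr q)) \<longlonglongrightarrow> 0"
      using ae
    proof eventually_elim
      case (elim x)
      have "(\<lambda>n. min (D n x) K) \<longlonglongrightarrow> min 0 K" by (intro tendsto_min elim tendsto_const)
      then have "(\<lambda>n. min (D n x) K) \<longlonglongrightarrow> 0" using K by simp
      then have "(\<lambda>n. min (D n x) K powr q) \<longlonglongrightarrow> 0 powr q"
        using q nonneg K by (intro tendsto_powr2) (auto intro!: always_eventually)
      then have "(\<lambda>n. min (D n x) K powr q) \<longlonglongrightarrow> 0" by simp
      from tendsto_ennrealI[OF this] show ?case by simp
    qed
  qed auto
  then have "eventually (\<lambda>n. (\<integral>\<^sup>+x. ennreal (min (D n x) K powr q) \<partial>M) < ennreal (e / 2)) sequentially"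
    using e by (intro order_tendstoD(2)[of _ 0]) auto
  then show "eventually (\<lambda>n. (\<integral>\<^sup>+x. ennreal (D n x powr q) \<partial>M) < a) sequentially"
    using eventually_ge_at_top[of N]
  proof eventually_elim
    case (elim n)
    have "(\<integral>\<^sup>+x. ennreal (D n x powr q) \<partial>M)
        \<le> (\<integral>\<^sup>+x. ennreal (min (D n x) K powr q) + ennreal (K powr (q - p)) * ennreal (D n x powr p) \<partial>M)"
      using split by (intro nn_integral_mono) (simp flip: ennreal_mult ennreal_plus add: ennreal_leI)
    also have "\<dots> = (\<integral>\<^sup>+x. ennreal (min (D n x) K powr q) \<partial>M)
        + ennreal (K powr (q - p)) * (\<integral>\<^sup>+x. ennreal (D n x powr p) \<partial>M)"
      by (subst nn_integral_add) (auto simp: nn_integral_cmult)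
    also have "\<dots> \<le> (\<integral>\<^sup>+x. ennreal (min (D n x) K powr q) \<partial>M) + ennreal (K powr (q - p)) * ennreal B"
      using elim(2) by (intro add_left_mono mult_left_mono bnd) auto
    also have "\<dots> \<le> ennreal (e / 2) + (\<integral>\<^sup>+x. ennreal (min (D n x) K powr q) \<partial>M)"
      using K by (subst add.commute, intro add_right_mono) (simp add: ennreal_leI less_imp_le flip: ennreal_mult')
    also have "\<dots> < ennreal (e / 2) + ennreal (e / 2)"
      using elim(1) by (simp only: ennreal_add_left_cancel_less) simp
    also have "\<dots> = ennreal e" using e by (simp flip: ennreal_plus)
    finally show ?case using e by simp
  qed
qed simp

locale iid_complex_sequence = prob_space M for M :: "'a measure" +
  fixes Y :: "nat \<Rightarrow> 'a \<Rightarrow> complex"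
  assumes indep: "indep_vars (\<lambda>_. borel) Y {1..}"
    and ident: "\<And>i. i \<ge> 1 \<Longrightarrow> distr M borel (Y i) = distr M borel (Y 1)"
begin

lemma measurable_Y: "i \<ge> 1 \<Longrightarrow> Y i \<in> borel_measurable M"
  using indep by (auto simp: indep_vars_def)

lemma measurable_Y1 [measurable]: "Y 1 \<in> borel_measurable M"
  by (rule measurable_Y) simp

lemma integrable_of_moment:
  assumes p: "p \<ge> 1" and mom: "integrable M (\<lambda>x. cmod (Y 1 x) powr p)"
  shows "integrable M (Y 1)"
proof (rule Bochner_Integration.integrable_bound[OF Bochner_Integration.integrable_add[OF integrable_const[of 1] mom]])
  show "AE x in M. norm (Y 1 x) \<le> norm (1 + cmod (Y 1 x) powr p)"
  proof (rule AE_I2)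
    fix x show "norm (Y 1 x) \<le> norm (1 + cmod (Y 1 x) powr p)"
      using powr_le_one_plus_powr[of "cmod (Y 1 x)" 1 p] p by simp
  qed
qed (rule measurable_Y1)

text \<open>The strong law for nonnegative variables is needed for the four positive and negative parts of a
complex variable and for its absolute value; all of them are of this form.\<close>
lemma strong_law_nonneg_function:
  fixes g :: "complex \<Rightarrow> real"
  assumes p: "p > 1" and mom: "integrable M (\<lambda>x. cmod (Y 1 x) powr p)"
    and g [measurable]: "g \<in> borel_measurable borel" and bnd: "\<And>z. 0 \<le> g z" "\<And>z. g z \<le> cmod z"
  shows "AE x in M. (\<lambda>n. (\<Sum>i=1..n. g (Y i x)) / real n) \<longlonglongrightarrow> expectation (\<lambda>x. g (Y 1 x))"
\<comment> \<open>The truncation argument uses an exponent of at most 2, so a higher moment is lowered to 2.\<close>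
proof (rule strong_law_nonneg[where p = "min p 2"])
  show "indep_vars (\<lambda>_. borel) (\<lambda>i x. g (Y i x)) {1..}"
    by (rule indep_vars_compose2[OF indep]) simp
  show "distr M borel (\<lambda>x. g (Y i x)) = distr M borel (\<lambda>x. g (Y 1 x))" if "i \<ge> 1" for i
  proof -
    have "distr M borel (\<lambda>x. g (Y j x)) = distr (distr M borel (Y j)) borel g" if "j \<ge> 1" for j
      using distr_distr[OF g, of "Y j" M] measurable_Y[OF that] by (simp add: comp_def)
    from this[OF that] this[of 1] show ?thesis using ident[OF that] by simp
  qed
  show "integrable M (\<lambda>x. g (Y 1 x) powr min p 2)"
  proof (rule Bochner_Integration.integrable_bound[OF Bochner_Integration.integrable_add[OF integrable_const[of 1] mom]])
    show "AE x in M. norm (g (Y 1 x) powr min p 2) \<le> norm (1 + cmod (Y 1 x) powr p)"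
    proof (rule AE_I2)
      fix x
      have "g (Y 1 x) powr min p 2 \<le> cmod (Y 1 x) powr min p 2"
        using bnd p by (intro powr_mono2) auto
      also have "\<dots> \<le> 1 + cmod (Y 1 x) powr p" using p by (intro powr_le_one_plus_powr) auto
      finally show "norm (g (Y 1 x) powr min p 2) \<le> norm (1 + cmod (Y 1 x) powr p)" by simp
    qed
    show "(\<lambda>x. g (Y 1 x) powr min p 2) \<in> borel_measurable M"
      using measurable_Y1 by measurable
  qed
qed (use p bnd in auto)

lemma strong_law:
  assumes p: "p > 1" and mom: "integrable M (\<lambda>x. cmod (Y 1 x) powr p)"
  shows "AE x in M. (\<lambda>n. (\<Sum>i=1..n. Y i x) / of_nat n) \<longlonglongrightarrow> integral\<^sup>L M (Y 1)"
proof -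
  let ?g1 = "\<lambda>z. max 0 (Re z)" and ?g2 = "\<lambda>z. max 0 (- Re z)"
  let ?g3 = "\<lambda>z. max 0 (Im z)" and ?g4 = "\<lambda>z. max 0 (- Im z)"
  have Y1: "integrable M (Y 1)" using integrable_of_moment[OF _ mom] p by simp
  have abs: "\<bar>Re z\<bar> \<le> cmod z" "\<bar>Im z\<bar> \<le> cmod z" for z
    by (rule abs_Re_le_cmod abs_Im_le_cmod)+
  note law = strong_law_nonneg_function[OF p mom]
  have decomp: "z = of_real (?g1 z) - of_real (?g2 z) + \<i> * (of_real (?g3 z) - of_real (?g4 z))" for z
    by (auto simp: complex_eq_iff max_def)
  have E: "integral\<^sup>L M (Y 1) = of_real (expectation (\<lambda>x. ?g1 (Y 1 x))) - of_real (expectation (\<lambda>x. ?g2 (Y 1 x)))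
     + \<i> * (of_real (expectation (\<lambda>x. ?g3 (Y 1 x))) - of_real (expectation (\<lambda>x. ?g4 (Y 1 x))))"
  proof -
    have part: "expectation f = expectation (\<lambda>x. max 0 (f x)) - expectation (\<lambda>x. max 0 (- f x))"
      if "integrable M f" for f :: "'a \<Rightarrow> real"
    proof -
      have "expectation f = expectation (\<lambda>x. max 0 (f x) - max 0 (- f x))"
        by (intro Bochner_Integration.integral_cong) (auto simp: max_def)
      also have "\<dots> = expectation (\<lambda>x. max 0 (f x)) - expectation (\<lambda>x. max 0 (- f x))"
        using that by (intro Bochner_Integration.integral_diff integrable_max) auto
      finally show ?thesis .
    qed
    have "Re (integral\<^sup>L M (Y 1)) = expectation (\<lambda>x. ?g1 (Y 1 x)) - expectation (\<lambda>x. ?g2 (Y 1 x))"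
      unfolding integral_Re[OF Y1, symmetric] by (rule part[OF integrable_Re[OF Y1]])
    moreover have "Im (integral\<^sup>L M (Y 1)) = expectation (\<lambda>x. ?g3 (Y 1 x)) - expectation (\<lambda>x. ?g4 (Y 1 x))"
      unfolding integral_Im[OF Y1, symmetric] by (rule part[OF integrable_Im[OF Y1]])
    ultimately show ?thesis by (intro complex_eqI) (simp_all del: One_nat_def)
  qed
  have "AE x in M. (\<lambda>n. (\<Sum>i=1..n. ?g1 (Y i x)) / real n) \<longlonglongrightarrow> expectation (\<lambda>x. ?g1 (Y 1 x))"
    by (rule law) (use abs in \<open>auto simp: abs_le_iff\<close>)
  moreover have "AE x in M. (\<lambda>n. (\<Sum>i=1..n. ?g2 (Y i x)) / real n) \<longlonglongrightarrow> expectation (\<lambda>x. ?g2 (Y 1 x))"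
    by (rule law) (use abs in \<open>auto simp: abs_le_iff\<close>)
  moreover have "AE x in M. (\<lambda>n. (\<Sum>i=1..n. ?g3 (Y i x)) / real n) \<longlonglongrightarrow> expectation (\<lambda>x. ?g3 (Y 1 x))"
    by (rule law) (use abs in \<open>auto simp: abs_le_iff\<close>)
  moreover have "AE x in M. (\<lambda>n. (\<Sum>i=1..n. ?g4 (Y i x)) / real n) \<longlonglongrightarrow> expectation (\<lambda>x. ?g4 (Y 1 x))"
    by (rule law) (use abs in \<open>auto simp: abs_le_iff\<close>)
  ultimately show ?thesis
  proof eventually_elim
    case (elim x)
    have "(\<lambda>n. of_real ((\<Sum>i=1..n. ?g1 (Y i x)) / real n) - of_real ((\<Sum>i=1..n. ?g2 (Y i x)) / real n)
       + \<i> * (of_real ((\<Sum>i=1..n. ?g3 (Y i x)) / real n) - of_real ((\<Sum>i=1..n. ?g4 (Y i x)) / real n)))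
       \<longlonglongrightarrow> integral\<^sup>L M (Y 1)"
      unfolding E by (intro tendsto_intros elim)
    moreover have "of_real ((\<Sum>i=1..n. ?g1 (Y i x)) / real n) - of_real ((\<Sum>i=1..n. ?g2 (Y i x)) / real n)
       + \<i> * (of_real ((\<Sum>i=1..n. ?g3 (Y i x)) / real n) - of_real ((\<Sum>i=1..n. ?g4 (Y i x)) / real n))
       = (\<Sum>i=1..n. Y i x) / of_nat n" for n
    proof -
      have "(\<Sum>i=1..n. Y i x) = (\<Sum>i=1..n. of_real (?g1 (Y i x)) - of_real (?g2 (Y i x))
         + \<i> * (of_real (?g3 (Y i x)) - of_real (?g4 (Y i x))))"
        by (subst decomp[symmetric]) simp
      then show ?thesis
        by (simp add: sum.distrib sum_subtractf sum_distrib_left[symmetric] add_divide_distrib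
            diff_divide_distrib right_diff_distrib)
    qed
    ultimately show ?case by (simp only:)
  qed
qed

lemma symmetric_mean_tendsto:
  assumes p: "p > 1" and mom: "integrable M (\<lambda>x. cmod (Y 1 x) powr p)"
  shows "AE x in M. (\<lambda>n. esym (\<lambda>i. Y i x) k n / of_nat (n choose k)) \<longlonglongrightarrow> integral\<^sup>L M (Y 1) ^ k"
proof -
  have "AE x in M. (\<lambda>n. (\<Sum>i=1..n. cmod (Y i x)) / real n) \<longlonglongrightarrow> expectation (\<lambda>x. cmod (Y 1 x))"
    by (rule strong_law_nonneg_function[OF p mom]) auto
  with strong_law[OF p mom] show ?thesis
    by eventually_elim (rule esym_mean_tendsto)
qed

lemma nn_integral_prod_powr:
  assumes L: "finite L" "L \<subseteq> {1..}"
  shows "(\<integral>\<^sup>+x. ennreal (cmod (\<Prod>l\<in>L. Y l x) powr p) \<partial>M) = (\<integral>\<^sup>+x. ennreal (cmod (Y 1 x) powr p) \<partial>M) ^ card L"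
proof -
  have ind: "indep_vars (\<lambda>_. borel) (\<lambda>l x. ennreal (cmod (Y l x) powr p)) L"
    by (rule indep_vars_compose2[OF indep_vars_subset[OF indep L(2)], where Y = "\<lambda>l y. ennreal (cmod y powr p)"]) measurable
  have "(\<integral>\<^sup>+x. ennreal (cmod (\<Prod>l\<in>L. Y l x) powr p) \<partial>M) = (\<integral>\<^sup>+x. (\<Prod>l\<in>L. ennreal (cmod (Y l x) powr p)) \<partial>M)"
    by (intro nn_integral_cong) (simp add: prod_norm[symmetric] prod_powr_distrib prod_ennreal)
  also have "\<dots> = (\<Prod>l\<in>L. \<integral>\<^sup>+x. ennreal (cmod (Y l x) powr p) \<partial>M)"
    by (rule indep_vars_nn_integral[OF L(1) ind]) simp
  also have "\<dots> = (\<Prod>l\<in>L. \<integral>\<^sup>+x. ennreal (cmod (Y 1 x) powr p) \<partial>M)"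
  proof (rule prod.cong)
    fix l assume "l \<in> L"
    then have l: "l \<ge> 1" using L by auto
    show "(\<integral>\<^sup>+x. ennreal (cmod (Y l x) powr p) \<partial>M) = (\<integral>\<^sup>+x. ennreal (cmod (Y 1 x) powr p) \<partial>M)"
      by (rule nn_integral_identically_distributed[OF ident[OF l] measurable_Y[OF l] measurable_Y1]) measurable
  qed simp
  finally show ?thesis by simp
qed

lemma measurable_prod_Y: "L \<subseteq> {1..} \<Longrightarrow> (\<lambda>x. \<Prod>l\<in>L. Y l x) \<in> borel_measurable M"
  by (intro borel_measurable_prod measurable_Y) auto

lemma expectation_prod_Y:
  assumes L: "finite L" "L \<subseteq> {1..}" and int: "integrable M (Y 1)"
  shows "integrable M (\<lambda>x. \<Prod>l\<in>L. Y l x)"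
    and "(\<integral>x. (\<Prod>l\<in>L. Y l x) \<partial>M) = integral\<^sup>L M (Y 1) ^ card L"
proof -
  have ind: "indep_vars (\<lambda>_. borel) Y L" by (rule indep_vars_subset[OF indep L(2)])
  have 1: "integrable M (Y l)" and 2: "integral\<^sup>L M (Y l) = integral\<^sup>L M (Y 1)" if "l \<in> L" for l
  proof -
    have l: "l \<ge> 1" using that L by auto
    show "integrable M (Y l)"
      using integrable_identically_distributed[OF ident[OF l] measurable_Y[OF l] measurable_Y1, of "\<lambda>y. y"] int by simp
    show "integral\<^sup>L M (Y l) = integral\<^sup>L M (Y 1)"
      using integral_identically_distributed[OF ident[OF l] measurable_Y[OF l] measurable_Y1, of "\<lambda>y. y"] by simp
  qed
  show "integrable M (\<lambda>x. \<Prod>l\<in>L. Y l x)" by (rule indep_vars_integrable[OF L(1) ind 1])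
  show "(\<integral>x. (\<Prod>l\<in>L. Y l x) \<partial>M) = integral\<^sup>L M (Y 1) ^ card L"
    by (subst indep_vars_lebesgue_integral[OF L(1) ind 1]) (simp_all add: 2)
qed

text \<open>The constant \<open>c\<close> is part of the definition because two values matter: \<open>c = \<alpha>\<close> gives the statistic
\<open>R\<close>, and \<open>c\<close> equal to the \<open>k\<close>-th power of the mean of \<open>Y 1\<close> gives the centered statistic. For
\<open>n < k\<close> the value is \<open>0\<close>.\<close>
definition symmetric_mean :: "nat \<Rightarrow> complex \<Rightarrow> nat \<Rightarrow> 'a \<Rightarrow> complex" where
  "symmetric_mean k c n x = (\<Sum>L | L \<subseteq> {1..n} \<and> card L = k. (\<Prod>l\<in>L. Y l x) - c) / of_nat (n choose k)"

lemma measurable_symmetric_mean [measurable]: "symmetric_mean k c n \<in> borel_measurable M"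
  unfolding symmetric_mean_def[abs_def]
  by (intro borel_measurable_divide borel_measurable_sum borel_measurable_diff measurable_prod_Y) auto

text \<open>The bound does not depend on \<open>n\<close>: by Jensen's inequality the mean over all \<open>k\<close>-subsets is no worse than
a single product, whose moment factorises by independence.\<close>
lemma symmetric_mean_moment_bound:
  assumes p: "p \<ge> 1" and n: "k \<le> n"
  shows "(\<integral>\<^sup>+x. ennreal (cmod (symmetric_mean k c n x) powr p) \<partial>M)
    \<le> ennreal (2 powr p) * ((\<integral>\<^sup>+x. ennreal (cmod (Y 1 x) powr p) \<partial>M) ^ k + ennreal (cmod c powr p))" (is "_ \<le> ?B")
proof -
  let ?S = "{L. L \<subseteq> {1..n} \<and> card L = k}"
  have fin: "finite ?S" by (rule finite_subset[of _ "Pow {1..n}"]) auto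
  have card: "card ?S = n choose k" using n_subsets[of "{1..n}" k] by simp
  have C: "n choose k > 0" using n by (simp add: zero_less_binomial)
  then have ne: "?S \<noteq> {}" using card fin by (metis card.empty less_irrefl)
  have [measurable]: "(\<lambda>x. \<Prod>l\<in>L. Y l x) \<in> borel_measurable M" if "L \<in> ?S" for L
    using that by (intro measurable_prod_Y) auto
  have each: "(\<integral>\<^sup>+x. ennreal (cmod ((\<Prod>l\<in>L. Y l x) - c) powr p) \<partial>M) \<le> ?B" if L: "L \<in> ?S" for L
  proof -
    have L': "finite L" "L \<subseteq> {1..}" "card L = k" using L finite_subset[of L "{1..n}"] by auto
    have [measurable]: "(\<lambda>x. \<Prod>l\<in>L. Y l x) \<in> borel_measurable M" by (rule measurable_prod_Y[OF L'(2)])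
    have "(\<integral>\<^sup>+x. ennreal (cmod ((\<Prod>l\<in>L. Y l x) - c) powr p) \<partial>M)
       \<le> (\<integral>\<^sup>+x. ennreal (2 powr p) * (ennreal (cmod (\<Prod>l\<in>L. Y l x) powr p) + ennreal (cmod c powr p)) \<partial>M)"
      using p norm_diff_powr_le[of p _ c]
      by (intro nn_integral_mono) (simp flip: ennreal_mult ennreal_plus add: ennreal_leI)
    also have "\<dots> = ennreal (2 powr p) * ((\<integral>\<^sup>+x. ennreal (cmod (\<Prod>l\<in>L. Y l x) powr p) \<partial>M) + ennreal (cmod c powr p))"
      by (subst nn_integral_cmult, measurable) (subst nn_integral_add; simp add: emeasure_space_1)
    finally show ?thesis using nn_integral_prod_powr[OF L'(1,2)] L'(3) by simp
  qed
  have "(\<integral>\<^sup>+x. ennreal (cmod ((\<Sum>L\<in>?S. (\<Prod>l\<in>L. Y l x) - c) / of_nat (n choose k)) powr p) \<partial>M)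
     \<le> (\<integral>\<^sup>+x. ennreal (1 / real (n choose k)) * (\<Sum>L\<in>?S. ennreal (cmod ((\<Prod>l\<in>L. Y l x) - c) powr p)) \<partial>M)"
  proof (rule nn_integral_mono)
    fix x
    have "cmod ((\<Sum>L\<in>?S. (\<Prod>l\<in>L. Y l x) - c) / of_nat (n choose k)) powr p
      \<le> 1 / real (n choose k) * (\<Sum>L\<in>?S. cmod ((\<Prod>l\<in>L. Y l x) - c) powr p)"
      using norm_mean_powr_le[OF fin ne p, of "\<lambda>L. (\<Prod>l\<in>L. Y l x) - c"] unfolding card by simp
    then show "ennreal (cmod ((\<Sum>L\<in>?S. (\<Prod>l\<in>L. Y l x) - c) / of_nat (n choose k)) powr p)
      \<le> ennreal (1 / real (n choose k)) * (\<Sum>L\<in>?S. ennreal (cmod ((\<Prod>l\<in>L. Y l x) - c) powr p))"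
      by (subst sum_ennreal) (simp_all add: ennreal_leI sum_nonneg flip: ennreal_mult)
  qed
  also have "\<dots> = ennreal (1 / real (n choose k)) * (\<Sum>L\<in>?S. \<integral>\<^sup>+x. ennreal (cmod ((\<Prod>l\<in>L. Y l x) - c) powr p) \<partial>M)"
    by (subst nn_integral_cmult; (subst nn_integral_sum)?) measurable
  also have "\<dots> \<le> ennreal (1 / real (n choose k)) * (\<Sum>L\<in>?S. ?B)"
    by (intro mult_left_mono sum_mono each) auto
  also have "\<dots> = (ennreal (1 / real (n choose k)) * ennreal (real (n choose k))) * ?B"
    by (simp only: sum_constant card ennreal_of_nat_eq_real_of_nat mult.assoc)
  also have "ennreal (1 / real (n choose k)) * ennreal (real (n choose k)) = 1"
    using C by (simp flip: ennreal_mult)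
  finally show ?thesis by (simp add: symmetric_mean_def)
qed

end

section \<open>Second moments of symmetric means\<close>

lemma card_subsets_containing:
  fixes A :: "'i set"
  assumes A: "finite A" and i: "i \<in> A" and k: "k > 0"
  shows "card {L. L \<subseteq> A \<and> card L = k \<and> i \<in> L} = (card A - 1) choose (k - 1)"
proof -
  let ?B = "{K. K \<subseteq> A - {i} \<and> card K = k - 1}"
  have "{L. L \<subseteq> A \<and> card L = k \<and> i \<in> L} = insert i ` ?B" (is "?L = ?R")
  proof (intro equalityI subsetI)
    fix L assume L: "L \<in> ?L"
    then have "finite L" using A finite_subset by blast
    then have "L - {i} \<in> ?B" and "L = insert i (L - {i})" using L by auto
    then show "L \<in> ?R" by blast
  next
    fix L assume "L \<in> ?R"
    then obtain K where K: "L = insert i K" "K \<subseteq> A - {i}" "card K = k - 1" by auto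
    then have "finite K" "i \<notin> K" using A finite_subset by fastforce+
    then show "L \<in> ?L" using K i k by auto
  qed
  moreover have "inj_on (insert i) ?B"
  proof (rule inj_onI)
    fix K K' assume "K \<in> ?B" "K' \<in> ?B" and eq: "insert i K = insert i K'"
    then have "i \<notin> K" "i \<notin> K'" by auto
    with eq show "K = K'" by (simp add: insert_ident)
  qed
  ultimately have "card {L. L \<subseteq> A \<and> card L = k \<and> i \<in> L} = card ?B" by (simp add: card_image)
  also have "\<dots> = (card A - 1) choose (k - 1)"
    using n_subsets[of "A - {i}" "k - 1"] A i by simp
  finally show ?thesis .
qed

text \<open>Writing \<open>card (L \<inter> L')\<close> as a sum of indicators over the points of \<open>A\<close> and exchanging the sums leaves
the square of the number of \<open>k\<close>-subsets through a given point. Equivalently, two independent uniform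
\<open>k\<close>-subsets of an \<open>n\<close>-set share \<open>k\<^sup>2 / n\<close> points on average.\<close>
lemma sum_card_intersections:
  fixes A :: "'i set"
  assumes A: "finite A" and k: "k > 0"
  defines "S \<equiv> {L. L \<subseteq> A \<and> card L = k}"
  shows "card A * (\<Sum>L\<in>S. \<Sum>L'\<in>S. card (L \<inter> L')) = (k * (card A choose k))\<^sup>2"
proof -
  have fin: "finite S" unfolding S_def by (rule finite_subset[of _ "Pow A"]) (use A in auto)
  let ?N = "(card A - 1) choose (k - 1)"
  have "(\<Sum>L\<in>S. \<Sum>L'\<in>S. card (L \<inter> L')) = (\<Sum>L\<in>S. \<Sum>L'\<in>S. \<Sum>i\<in>A. of_bool (i \<in> L) * of_bool (i \<in> L'))"
  proof (intro sum.cong refl)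
    fix L L' assume "L \<in> S" "L' \<in> S"
    then have "L \<inter> L' = A \<inter> {i. i \<in> L \<and> i \<in> L'}" by (auto simp: S_def)
    then show "card (L \<inter> L') = (\<Sum>i\<in>A. of_bool (i \<in> L) * of_bool (i \<in> L'))"
      using A by (simp flip: of_bool_conj add: sum_of_bool_eq)
  qed
  also have "\<dots> = (\<Sum>L\<in>S. \<Sum>i\<in>A. \<Sum>L'\<in>S. of_bool (i \<in> L) * of_bool (i \<in> L'))"
    by (intro sum.cong refl sum.swap)
  also have "\<dots> = (\<Sum>i\<in>A. \<Sum>L\<in>S. \<Sum>L'\<in>S. of_bool (i \<in> L) * of_bool (i \<in> L'))"
    by (rule sum.swap)
  also have "\<dots> = (\<Sum>i\<in>A. (card {L \<in> S. i \<in> L})\<^sup>2)"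
  proof (intro sum.cong refl)
    fix i
    have "(\<Sum>L\<in>S. of_bool (i \<in> L)) = card {L \<in> S. i \<in> L}"
      using fin by (simp add: sum_of_bool_eq Int_def)
    then show "(\<Sum>L\<in>S. \<Sum>L'\<in>S. of_bool (i \<in> L) * of_bool (i \<in> L')) = (card {L \<in> S. i \<in> L})\<^sup>2"
      by (simp add: sum_product[symmetric] power2_eq_square)
  qed
  also have "\<dots> = (\<Sum>i\<in>A. ?N\<^sup>2)"
    using card_subsets_containing[OF A _ k] by (intro sum.cong refl) (simp add: S_def conj_ac)
  finally have "card A * (\<Sum>L\<in>S. \<Sum>L'\<in>S. card (L \<inter> L')) = (card A * ?N)\<^sup>2"
    by (simp add: power2_eq_square)
  then show ?thesis using times_binomial_minus1_eq[OF k, of "card A"] by simp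
qed

text \<open>With \<open>s\<close> the second absolute moment of \<open>Y 1\<close> and \<open>t\<close> the squared absolute value of its mean, this is
the covariance of two products of \<open>m\<close> variables each that have \<open>k\<close> variables in common.\<close>
definition overlap_covariance :: "real \<Rightarrow> real \<Rightarrow> nat \<Rightarrow> nat \<Rightarrow> real" where
  "overlap_covariance s t m k = s ^ k * t ^ (m - k) - t ^ m"

lemma overlap_covariance_eq_sum:
  assumes "k \<le> m"
  shows "overlap_covariance s t m k = (s - t) * (\<Sum>j<k. s ^ j * t ^ (m - 1 - j))"
proof -
  have "(s - t) * (\<Sum>j<k. s ^ j * t ^ (m - 1 - j)) = (\<Sum>j<k. s ^ Suc j * t ^ (m - Suc j) - s ^ j * t ^ (m - j))"
    unfolding sum_distrib_left
  proof (intro sum.cong refl)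
    fix j assume "j \<in> {..<k}"
    then obtain i where i: "m = Suc (j + i)" using assms less_imp_Suc_add[of j m] by auto
    show "(s - t) * (s ^ j * t ^ (m - 1 - j)) = s ^ Suc j * t ^ (m - Suc j) - s ^ j * t ^ (m - j)"
      by (simp add: i Suc_diff_le algebra_simps)
  qed
  also have "\<dots> = overlap_covariance s t m k"
    by (rule sum_lessThan_telescope[of "\<lambda>j. s ^ j * t ^ (m - j)" k, THEN trans])
      (simp add: overlap_covariance_def)
  finally show ?thesis by simp
qed

text \<open>As a function of the overlap \<open>k\<close> the covariance vanishes at \<open>0\<close> and has nondecreasing increments, so it
is convex. Hence it lies above the line through its values at \<open>0\<close> and \<open>1\<close> and below the chord from \<open>0\<close> to
\<open>m\<close>. These two linear bounds are what makes the distribution of the overlap irrelevant except for its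
mean.\<close>
lemma overlap_covariance_bounds:
  assumes k: "k \<le> m" and st: "0 \<le> t" "t \<le> s"
  shows "real k * overlap_covariance s t m 1 \<le> overlap_covariance s t m k"
    and "real m * overlap_covariance s t m k \<le> real k * overlap_covariance s t m m"
proof -
  define a where "a j = s ^ j * t ^ (m - 1 - j)" for j
  have amono: "a i \<le> a j" if "i \<le> j" "j \<le> m - 1" for i j
  proof -
    have "m - 1 - i = (j - i) + (m - 1 - j)" "j = i + (j - i)" using that by auto
    then have e: "t ^ (m - 1 - i) = t ^ (j - i) * t ^ (m - 1 - j)" "s ^ j = s ^ i * s ^ (j - i)"
      by (metis power_add)+
    have "s ^ i * t ^ (j - i) * t ^ (m - 1 - j) \<le> s ^ i * s ^ (j - i) * t ^ (m - 1 - j)"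
      using st by (intro mult_right_mono mult_left_mono power_mono) auto
    then show ?thesis unfolding a_def e by (simp only: mult_ac)
  qed
  show "real k * overlap_covariance s t m 1 \<le> overlap_covariance s t m k"
  proof (cases "k = 0")
    case True then show ?thesis by (simp add: overlap_covariance_def)
  next
    case False
    have "real k * a 0 = (\<Sum>j<k. a 0)" by simp
    also have "\<dots> \<le> (\<Sum>j<k. a j)" using k by (intro sum_mono amono) auto
    finally have "(s - t) * (real k * a 0) \<le> (s - t) * (\<Sum>j<k. a j)" using st by (intro mult_left_mono) auto
    moreover have "overlap_covariance s t m 1 = (s - t) * a 0"
      using overlap_covariance_eq_sum[of 1 m s t] False k by (simp add: a_def)
    ultimately show ?thesis using overlap_covariance_eq_sum[OF k, of s t] by (simp add: a_def mult_ac)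
  qed
  have "real m * (\<Sum>j<k. a j) \<le> real k * (\<Sum>j<m. a j)"
  proof -
    have split: "(\<Sum>j<m. a j) = (\<Sum>j<k. a j) + (\<Sum>j\<in>{k..<m}. a j)"
      using sum.atLeastLessThan_concat[of 0 k m a] k by (simp add: lessThan_atLeast0)
    have "real (m - k) * (\<Sum>j<k. a j) = (\<Sum>j<k. \<Sum>i\<in>{k..<m}. a j)" by (simp add: sum_distrib_left)
    also have "\<dots> \<le> (\<Sum>j<k. \<Sum>i\<in>{k..<m}. a i)" by (intro sum_mono amono) auto
    also have "\<dots> = real k * (\<Sum>i\<in>{k..<m}. a i)" by simp
    finally show ?thesis using k by (simp add: split of_nat_diff algebra_simps)
  qed
  then have "(s - t) * (real m * (\<Sum>j<k. a j)) \<le> (s - t) * (real k * (\<Sum>j<m. a j))"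
    using st by (intro mult_left_mono) auto
  then show "real m * overlap_covariance s t m k \<le> real k * overlap_covariance s t m m"
    using overlap_covariance_eq_sum[OF k, of s t] overlap_covariance_eq_sum[of m m s t] by (simp add: a_def mult_ac)
qed

context iid_complex_sequence
begin

context
  fixes s :: real and \<mu> :: complex
  assumes sq: "integrable M (\<lambda>x. (cmod (Y 1 x))\<^sup>2)"
  defines "s \<equiv> expectation (\<lambda>x. (cmod (Y 1 x))\<^sup>2)" and "\<mu> \<equiv> integral\<^sup>L M (Y 1)"
begin

lemma integrable_Y1: "integrable M (Y 1)"
proof (rule integrable_of_moment[where p = 2])
  show "integrable M (\<lambda>x. cmod (Y 1 x) powr 2)" using sq by simp
qed simp

text \<open>The product splits over \<open>L \<union> L'\<close> into independent factors: \<open>(cmod (Y l))\<^sup>2\<close> at common indices, \<open>Y l\<close>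
or its conjugate elsewhere.\<close>
lemma expectation_prod_cnj_prod:
  assumes L: "finite L" "L \<subseteq> {1..}" "finite L'" "L' \<subseteq> {1..}"
  shows "integrable M (\<lambda>x. (\<Prod>l\<in>L. Y l x) * cnj (\<Prod>l\<in>L'. Y l x))"
    and "(\<integral>x. (\<Prod>l\<in>L. Y l x) * cnj (\<Prod>l\<in>L'. Y l x) \<partial>M)
       = of_real s ^ card (L \<inter> L') * \<mu> ^ card (L - L') * cnj \<mu> ^ card (L' - L)"
proof -
  define h where "h l y = (if l \<in> L then y else 1) * (if l \<in> L' then cnj y else 1)" for l and y :: complex
  have h [measurable]: "h l \<in> borel_measurable borel" for l unfolding h_def
    by (cases "l \<in> L"; cases "l \<in> L'")
      (auto intro!: borel_measurable_continuous_onI continuous_intros)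
  define v where "v l = (if l \<in> L \<inter> L' then of_real s else if l \<in> L then \<mu> else cnj \<mu>)" for l
  have U: "finite (L \<union> L')" "L \<union> L' \<subseteq> {1..}" using L by auto
  have ind: "indep_vars (\<lambda>_. borel) (\<lambda>l x. h l (Y l x)) (L \<union> L')"
    by (rule indep_vars_compose2[OF indep_vars_subset[OF indep U(2)]]) simp
  have one: "integrable M (\<lambda>x. h l (Y l x)) \<and> (\<integral>x. h l (Y l x) \<partial>M) = v l" if l: "l \<in> L \<union> L'" for l
  proof -
    have l1: "l \<ge> 1" using l U by auto
    have "integrable M (\<lambda>x. h l (Y 1 x)) \<and> (\<integral>x. h l (Y 1 x) \<partial>M) = v l"
    proof -
      consider "l \<in> L \<inter> L'" | "l \<in> L - L'" | "l \<in> L' - L" using l by blast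
      then show ?thesis
      proof cases
        case 1
        then have "h l y = of_real ((cmod y)\<^sup>2)" for y unfolding complex_norm_square by (simp add: h_def)
        then show ?thesis using 1 sq unfolding s_def v_def by (simp del: of_real_power One_nat_def)
      next
        case 2
        then show ?thesis using integrable_Y1 by (simp add: h_def v_def \<mu>_def)
      next
        case 3
        then show ?thesis using integrable_Y1 by (simp add: h_def v_def \<mu>_def)
      qed
    qed
    then show ?thesis
      using integrable_identically_distributed[OF ident[OF l1] measurable_Y[OF l1] measurable_Y1 h]
        integral_identically_distributed[OF ident[OF l1] measurable_Y[OF l1] measurable_Y1 h] by metis
  qed
  have eq: "(\<Prod>l\<in>L. Y l x) * cnj (\<Prod>l\<in>L'. Y l x) = (\<Prod>l\<in>L \<union> L'. h l (Y l x))" for x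
  proof -
    have "(\<Prod>l\<in>L. Y l x) = (\<Prod>l\<in>L \<union> L'. if l \<in> L then Y l x else 1)"
      using U by (intro prod.mono_neutral_cong_left) auto
    moreover have "cnj (\<Prod>l\<in>L'. Y l x) = (\<Prod>l\<in>L \<union> L'. if l \<in> L' then cnj (Y l x) else 1)"
      unfolding cnj_prod using U by (intro prod.mono_neutral_cong_left) auto
    ultimately show ?thesis by (simp add: h_def prod.distrib)
  qed
  show "integrable M (\<lambda>x. (\<Prod>l\<in>L. Y l x) * cnj (\<Prod>l\<in>L'. Y l x))"
    unfolding eq using one by (intro indep_vars_integrable[OF U(1) ind]) blast
  have "(\<integral>x. (\<Prod>l\<in>L. Y l x) * cnj (\<Prod>l\<in>L'. Y l x) \<partial>M) = (\<Prod>l\<in>L \<union> L'. \<integral>x. h l (Y l x) \<partial>M)"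
    unfolding eq using one by (intro indep_vars_lebesgue_integral[OF U(1) ind]) blast
  also have "\<dots> = (\<Prod>l\<in>L \<union> L'. v l)" using one by (intro prod.cong) auto
  also have "L \<union> L' = (L \<inter> L') \<union> ((L - L') \<union> (L' - L))" by auto
  also have "(\<Prod>l\<in>\<dots>. v l) = (\<Prod>l\<in>L \<inter> L'. v l) * ((\<Prod>l\<in>L - L'. v l) * (\<Prod>l\<in>L' - L. v l))"
    using L by (subst prod.union_disjoint; (subst prod.union_disjoint)?) auto
  also have "\<dots> = of_real s ^ card (L \<inter> L') * \<mu> ^ card (L - L') * cnj \<mu> ^ card (L' - L)"
    by (simp add: v_def)
  finally show "(\<integral>x. (\<Prod>l\<in>L. Y l x) * cnj (\<Prod>l\<in>L'. Y l x) \<partial>M)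
       = of_real s ^ card (L \<inter> L') * \<mu> ^ card (L - L') * cnj \<mu> ^ card (L' - L)" .
qed

lemma covariance_prod:
  assumes L: "finite L" "L \<subseteq> {1..}" "card L = m" "finite L'" "L' \<subseteq> {1..}" "card L' = m"
  shows "integrable M (\<lambda>x. ((\<Prod>l\<in>L. Y l x) - \<mu> ^ m) * cnj ((\<Prod>l\<in>L'. Y l x) - \<mu> ^ m))"
    and "(\<integral>x. ((\<Prod>l\<in>L. Y l x) - \<mu> ^ m) * cnj ((\<Prod>l\<in>L'. Y l x) - \<mu> ^ m) \<partial>M)
       = of_real (overlap_covariance s ((cmod \<mu>)\<^sup>2) m (card (L \<inter> L')))"
proof -
  let ?k = "card (L \<inter> L')"
  let ?P = "\<lambda>x. \<Prod>l\<in>L. Y l x" and ?Q = "\<lambda>x. \<Prod>l\<in>L'. Y l x"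
  note PQ = expectation_prod_cnj_prod[OF L(1,2,4,5)]
  note P = expectation_prod_Y[OF L(1,2) integrable_Y1]
  note Q = expectation_prod_Y[OF L(4,5) integrable_Y1]
  have eq: "(?P x - \<mu> ^ m) * cnj (?Q x - \<mu> ^ m) = ?P x * cnj (?Q x) - ?P x * cnj (\<mu> ^ m) - \<mu> ^ m * cnj (?Q x) + \<mu> ^ m * cnj (\<mu> ^ m)" for x
    by (simp only: complex_cnj_diff) (simp add: algebra_simps)
  have ints: "integrable M (\<lambda>x. ?P x * cnj (\<mu> ^ m))" "integrable M (\<lambda>x. \<mu> ^ m * cnj (?Q x))"
    by (intro integrable_mult_left P(1), intro integrable_mult_right integrable_cnj Q(1))
  show "integrable M (\<lambda>x. (?P x - \<mu> ^ m) * cnj (?Q x - \<mu> ^ m))"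
    unfolding eq
    by (intro Bochner_Integration.integrable_add Bochner_Integration.integrable_diff PQ(1) ints integrable_const)
  have card: "card (L - L') = m - ?k" "card (L' - L) = m - ?k"
    using card_Diff_subset_Int[of L L'] card_Diff_subset_Int[of L' L] L by (auto simp: Int_commute)
  have "(\<integral>x. (?P x - \<mu> ^ m) * cnj (?Q x - \<mu> ^ m) \<partial>M)
     = (\<integral>x. ?P x * cnj (?Q x) \<partial>M) - (\<integral>x. ?P x * cnj (\<mu> ^ m) \<partial>M) - (\<integral>x. \<mu> ^ m * cnj (?Q x) \<partial>M) + \<mu> ^ m * cnj (\<mu> ^ m)"
    unfolding eq
    by (subst Bochner_Integration.integral_add, intro Bochner_Integration.integrable_diff PQ(1) ints, intro integrable_const,
        subst Bochner_Integration.integral_diff, intro Bochner_Integration.integrable_diff PQ(1) ints, rule ints,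
        subst Bochner_Integration.integral_diff, rule PQ(1), rule ints, simp add: prob_space)
  also have "(\<integral>x. ?P x * cnj (\<mu> ^ m) \<partial>M) = \<mu> ^ m * cnj (\<mu> ^ m)"
    unfolding integral_mult_left_zero P(2) L(3) \<mu>_def ..
  also have "(\<integral>x. \<mu> ^ m * cnj (?Q x) \<partial>M) = \<mu> ^ m * cnj (\<mu> ^ m)"
    unfolding integral_mult_right_zero Bochner_Integration.integral_cnj Q(2) L(6) \<mu>_def ..
  also have "(\<integral>x. ?P x * cnj (?Q x) \<partial>M) = of_real s ^ ?k * (\<mu> * cnj \<mu>) ^ (m - ?k)"
    unfolding PQ(2) card by (simp add: power_mult_distrib mult.assoc)
  also have "\<mu> ^ m * cnj (\<mu> ^ m) = (\<mu> * cnj \<mu>) ^ m" by (simp add: power_mult_distrib)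
  also have "\<mu> * cnj \<mu> = of_real ((cmod \<mu>)\<^sup>2)" by (rule complex_norm_square[symmetric])
  finally show "(\<integral>x. (?P x - \<mu> ^ m) * cnj (?Q x - \<mu> ^ m) \<partial>M)
       = of_real (overlap_covariance s ((cmod \<mu>)\<^sup>2) m ?k)"
    by (simp add: overlap_covariance_def)
qed

lemma variance_sum_prod:
  assumes S: "finite S" "\<And>L. L \<in> S \<Longrightarrow> finite L \<and> L \<subseteq> {1..} \<and> card L = m"
  shows "(\<integral>\<^sup>+x. ennreal ((cmod (\<Sum>L\<in>S. (\<Prod>l\<in>L. Y l x) - \<mu> ^ m))\<^sup>2) \<partial>M)
       = ennreal (\<Sum>L\<in>S. \<Sum>L'\<in>S. overlap_covariance s ((cmod \<mu>)\<^sup>2) m (card (L \<inter> L')))" (is "_ = ennreal ?V")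
    and "0 \<le> (\<Sum>L\<in>S. \<Sum>L'\<in>S. overlap_covariance s ((cmod \<mu>)\<^sup>2) m (card (L \<inter> L')))"
proof -
  let ?A = "\<lambda>L x. (\<Prod>l\<in>L. Y l x) - \<mu> ^ m"
  let ?q = "\<lambda>x. (cmod (\<Sum>L\<in>S. ?A L x))\<^sup>2"
  have cov: "integrable M (\<lambda>x. ?A L x * cnj (?A L' x))"
     "(\<integral>x. ?A L x * cnj (?A L' x) \<partial>M) = of_real (overlap_covariance s ((cmod \<mu>)\<^sup>2) m (card (L \<inter> L')))"
    if "L \<in> S" "L' \<in> S" for L L'
    using covariance_prod[of L m L'] S(2)[OF that(1)] S(2)[OF that(2)] by auto
  have eq: "of_real (?q x) = (\<Sum>L\<in>S. \<Sum>L'\<in>S. ?A L x * cnj (?A L' x))" for x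
    unfolding complex_norm_square cnj_sum by (rule sum_product)
  have int': "integrable M (\<lambda>x. complex_of_real (?q x))"
    unfolding eq by (intro Bochner_Integration.integrable_sum cov)
  then have int: "integrable M ?q" using integrable_Re[OF int'] by simp
  have "complex_of_real (expectation ?q) = (\<integral>x. of_real (?q x) \<partial>M)"
    by (rule integral_complex_of_real[symmetric])
  also have "\<dots> = (\<Sum>L\<in>S. \<Sum>L'\<in>S. (\<integral>x. ?A L x * cnj (?A L' x) \<partial>M))"
    unfolding eq
    by (subst Bochner_Integration.integral_sum, intro Bochner_Integration.integrable_sum cov, assumption+)
      (intro sum.cong refl Bochner_Integration.integral_sum cov)
  also have "\<dots> = of_real ?V" using cov(2) by simp
  finally have E: "expectation ?q = ?V" by (simp only: of_real_eq_iff)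
  show "(\<integral>\<^sup>+x. ennreal (?q x) \<partial>M) = ennreal ?V"
    unfolding E[symmetric] by (rule nn_integral_eq_integral[OF int]) simp
  show "0 \<le> ?V" unfolding E[symmetric] by (intro integral_nonneg_AE) simp
qed

text \<open>The difference of the two sides is the variance of the single variable \<open>Y 1\<close>.\<close>
lemma cmod_mean_squared_le: "(cmod \<mu>)\<^sup>2 \<le> s"
proof -
  have "0 \<le> (\<Sum>L\<in>{{1::nat}}. \<Sum>L'\<in>{{1::nat}}. overlap_covariance s ((cmod \<mu>)\<^sup>2) 1 (card (L \<inter> L')))"
    by (rule variance_sum_prod(2)) auto
  then show ?thesis by (simp add: overlap_covariance_def)
qed

text \<open>Inserting the two linear bounds for the covariance turns the double sum over pairs of subsets into the
double sum of the overlaps, which is known exactly.\<close>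
lemma variance_sum_prod_bounds:
  fixes m n :: nat
  assumes m: "m \<ge> 1" and n: "m \<le> n"
  defines "S \<equiv> {L. L \<subseteq> {1..n} \<and> card L = m}" and "t \<equiv> (cmod \<mu>)\<^sup>2" and "C \<equiv> real (n choose m)"
  defines "V \<equiv> (\<Sum>L\<in>S. \<Sum>L'\<in>S. overlap_covariance s t m (card (L \<inter> L')))"
  shows "(real m)\<^sup>2 * overlap_covariance s t m 1 \<le> real n * (V / C\<^sup>2)"
    and "real n * (V / C\<^sup>2) \<le> real m * overlap_covariance s t m m"
proof -
  have t: "0 \<le> t" "t \<le> s" unfolding t_def using cmod_mean_squared_le by auto
  have C: "C > 0" unfolding C_def using n by (simp add: zero_less_binomial)
  define T where "T = real (\<Sum>L\<in>S. \<Sum>L'\<in>S. card (L \<inter> L'))"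
  have T: "real n * T = (real m * C)\<^sup>2"
    using arg_cong[OF sum_card_intersections[of "{1..n}" m], of real] m
    by (simp add: T_def S_def C_def)
  have k: "card (L \<inter> L') \<le> m" if "L \<in> S" for L L'
    using that card_mono[of L "L \<inter> L'"] finite_subset[of L "{1..n}"] by (auto simp: S_def)
  have "T * overlap_covariance s t m 1 = (\<Sum>L\<in>S. \<Sum>L'\<in>S. real (card (L \<inter> L')) * overlap_covariance s t m 1)"
    by (simp add: T_def sum_distrib_right)
  also have "\<dots> \<le> V" unfolding V_def by (intro sum_mono overlap_covariance_bounds k t)
  finally have lo: "T * overlap_covariance s t m 1 \<le> V" .
  have "real m * V = (\<Sum>L\<in>S. \<Sum>L'\<in>S. real m * overlap_covariance s t m (card (L \<inter> L')))"
    by (simp add: V_def sum_distrib_left)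
  also have "\<dots> \<le> (\<Sum>L\<in>S. \<Sum>L'\<in>S. real (card (L \<inter> L')) * overlap_covariance s t m m)"
    by (intro sum_mono overlap_covariance_bounds k t)
  also have "\<dots> = T * overlap_covariance s t m m" by (simp add: T_def sum_distrib_right)
  finally have up: "real m * V \<le> T * overlap_covariance s t m m" .
  have "real n * (T * overlap_covariance s t m 1) \<le> real n * V" using lo by (intro mult_left_mono) auto
  then have "(real m * C)\<^sup>2 * overlap_covariance s t m 1 \<le> real n * V"
    using T by (simp add: mult.assoc[symmetric])
  then show "(real m)\<^sup>2 * overlap_covariance s t m 1 \<le> real n * (V / C\<^sup>2)"
    using C by (simp add: field_simps power_mult_distrib)
  have "real n * (real m * V) \<le> real n * (T * overlap_covariance s t m m)" using up by (intro mult_left_mono) auto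
  then have "real m * (real n * V) \<le> real m * (real m * (C\<^sup>2 * overlap_covariance s t m m))"
    using T by (simp add: mult.assoc[symmetric] power_mult_distrib) (simp add: power2_eq_square mult_ac)
  then have "real n * V \<le> real m * (C\<^sup>2 * overlap_covariance s t m m)" using m by simp
  then show "real n * (V / C\<^sup>2) \<le> real m * overlap_covariance s t m m"
    using C by (simp add: field_simps)
qed

end

end

text \<open>This is where the constant of the lower variance bound comes from: \<open>s ^ m - t ^ m\<close> is at most
\<open>m * s ^ (m - 1) * (s - t)\<close> by the mean value estimate, and one more factor \<open>t / s \<le> 1\<close> is given
away.\<close>
lemma variance_ratio_bound:
  fixes s t :: real
  assumes s: "s > 0" and t: "0 \<le> t" "t \<le> s" and m: "m \<ge> 1"
  shows "overlap_covariance s t m m * (t ^ m / s ^ m) \<le> real m * overlap_covariance s t m 1"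
proof -
  have eq1: "overlap_covariance s t m 1 = (s - t) * t ^ (m - 1)"
    using overlap_covariance_eq_sum[OF m, of s t] by simp
  have "(\<Sum>j<m. s ^ j * t ^ (m - 1 - j)) \<le> (\<Sum>j<m. s ^ (m - 1))"
  proof (rule sum_mono)
    fix j assume "j \<in> {..<m}"
    then have "s ^ (m - 1) = s ^ j * s ^ (m - 1 - j)" by (simp flip: power_add)
    then show "s ^ j * t ^ (m - 1 - j) \<le> s ^ (m - 1)" using s t by (simp add: power_mono)
  qed
  then have "overlap_covariance s t m m \<le> (s - t) * (real m * s ^ (m - 1))"
    unfolding overlap_covariance_eq_sum[OF order_refl] using t by (intro mult_left_mono) auto
  then have "overlap_covariance s t m m * (t ^ m / s ^ m) \<le> (s - t) * (real m * s ^ (m - 1)) * (t ^ m / s ^ m)"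
    using s t by (intro mult_right_mono) auto
  also have "\<dots> = real m * ((s - t) * t ^ (m - 1)) * (t / s)"
  proof -
    have "t ^ m = t * t ^ (m - 1)" "s ^ m = s * s ^ (m - 1)" using m by (simp_all flip: power_Suc)
    then show ?thesis using s by (simp add: field_simps)
  qed
  also have "\<dots> \<le> real m * ((s - t) * t ^ (m - 1)) * 1"
    using s t by (intro mult_left_mono) auto
  finally show ?thesis using eq1 by simp
qed

section \<open>Limit theorem and variance bounds\<close>

context iid_complex_sequence
begin

lemma symmetric_mean_shift:
  assumes "k \<le> n"
  shows "symmetric_mean k c n x - d = symmetric_mean k (c + d) n x"
proof -
  have C: "n choose k > 0" using assms by (simp add: zero_less_binomial)
  have "(\<Sum>L | L \<subseteq> {1..n} \<and> card L = k. d) = of_nat (n choose k) * d"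
    using n_subsets[of "{1..n}" k] by simp
  then have "(\<Sum>L | L \<subseteq> {1..n} \<and> card L = k. (\<Prod>l\<in>L. Y l x) - (c + d))
     = (\<Sum>L | L \<subseteq> {1..n} \<and> card L = k. (\<Prod>l\<in>L. Y l x) - c) - of_nat (n choose k) * d"
    by (simp only: diff_diff_eq[symmetric] sum_subtractf[where g = "\<lambda>_. d"])
  then show ?thesis using C by (simp only: symmetric_mean_def diff_divide_distrib) simp
qed

lemma symmetric_mean_eq_esym:
  assumes "k \<le> n"
  shows "symmetric_mean k c n x = esym (\<lambda>i. Y i x) k n / of_nat (n choose k) - c"
  using symmetric_mean_shift[OF assms, of 0 x c] by (simp add: symmetric_mean_def esym_def)

lemma expectation_symmetric_mean:
  assumes int: "integrable M (Y 1)" and n: "k \<le> n"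
  shows "integral\<^sup>L M (symmetric_mean k c n) = integral\<^sup>L M (Y 1) ^ k - c"
proof -
  let ?S = "{L. L \<subseteq> {1..n} \<and> card L = k}"
  have C: "n choose k > 0" using n by (simp add: zero_less_binomial)
  have P: "integrable M (\<lambda>x. \<Prod>l\<in>L. Y l x)" "(\<integral>x. (\<Prod>l\<in>L. Y l x) \<partial>M) = integral\<^sup>L M (Y 1) ^ k"
    if "L \<in> ?S" for L
  proof -
    have L: "finite L" "L \<subseteq> {1..}" "card L = k" using that finite_subset[of L "{1..n}"] by auto
    show "integrable M (\<lambda>x. \<Prod>l\<in>L. Y l x)" "(\<integral>x. (\<Prod>l\<in>L. Y l x) \<partial>M) = integral\<^sup>L M (Y 1) ^ k"
      using expectation_prod_Y[OF L(1,2) int] L(3) by simp_all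
  qed
  have "(\<integral>x. (\<Sum>L\<in>?S. (\<Prod>l\<in>L. Y l x) - c) \<partial>M) = (\<Sum>L\<in>?S. (\<integral>x. (\<Prod>l\<in>L. Y l x) - c \<partial>M))"
    by (intro Bochner_Integration.integral_sum Bochner_Integration.integrable_diff P integrable_const)
  also have "\<dots> = (\<Sum>L\<in>?S. integral\<^sup>L M (Y 1) ^ k - c)"
  proof (intro sum.cong refl)
    fix L assume L: "L \<in> ?S"
    show "(\<integral>x. (\<Prod>l\<in>L. Y l x) - c \<partial>M) = integral\<^sup>L M (Y 1) ^ k - c"
      using P[OF L] by (subst Bochner_Integration.integral_diff) (auto simp: prob_space)
  qed
  also have "\<dots> = of_nat (n choose k) * (integral\<^sup>L M (Y 1) ^ k - c)"
    using n_subsets[of "{1..n}" k] by simp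
  finally show ?thesis using C unfolding symmetric_mean_def[abs_def] integral_divide_zero by simp
qed

lemma symmetric_mean_AE_tendsto:
  assumes p: "p > 1" and mom: "integrable M (\<lambda>x. cmod (Y 1 x) powr p)"
  shows "AE x in M. (\<lambda>n. symmetric_mean k c n x) \<longlonglongrightarrow> integral\<^sup>L M (Y 1) ^ k - c"
  using symmetric_mean_tendsto[OF p mom, of k]
proof eventually_elim
  case (elim x)
  show ?case
  proof (rule Lim_transform_eventually[OF tendsto_diff[OF elim tendsto_const]])
    show "eventually (\<lambda>n. esym (\<lambda>i. Y i x) k n / of_nat (n choose k) - c = symmetric_mean k c n x) sequentially"
      using eventually_ge_at_top[of k] by eventually_elim (simp add: symmetric_mean_eq_esym)
  qed
qed

lemma symmetric_mean_moment_finite: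
  assumes p: "p \<ge> 1" and mom: "integrable M (\<lambda>x. cmod (Y 1 x) powr p)"
  obtains B where "\<And>n. n \<ge> k \<Longrightarrow> (\<integral>\<^sup>+x. ennreal (cmod (symmetric_mean k c n x) powr p) \<partial>M) \<le> ennreal B"
proof
  let ?I = "expectation (\<lambda>x. cmod (Y 1 x) powr p)"
  fix n assume n: "n \<ge> k"
  have I: "(\<integral>\<^sup>+x. ennreal (cmod (Y 1 x) powr p) \<partial>M) = ennreal ?I" "0 \<le> ?I"
    using mom by (auto intro!: nn_integral_eq_integral integral_nonneg_AE)
  have "(\<integral>\<^sup>+x. ennreal (cmod (symmetric_mean k c n x) powr p) \<partial>M) \<le> ennreal (2 powr p) * (ennreal ?I ^ k + ennreal (cmod c powr p))"
    using symmetric_mean_moment_bound[OF p n, of c] unfolding I(1) .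
  also have "\<dots> = ennreal (2 powr p * (?I ^ k + cmod c powr p))"
    using I(2) by (simp add: ennreal_power flip: ennreal_plus ennreal_mult)
  finally show "(\<integral>\<^sup>+x. ennreal (cmod (symmetric_mean k c n x) powr p) \<partial>M) \<le> ennreal (2 powr p * (?I ^ k + cmod c powr p))" .
qed

text \<open>The centered statistic has a bounded moment of order \<open>p\<close>, so the almost sure limit is also a limit in
every smaller order. Membership in the \<open>L\<close> spaces is asserted for all \<open>n\<close>; for
\<open>n < k\<close> the statistic is constantly \<open>0\<close>.\<close>
lemma symmetric_mean_tendsto_L:
  assumes p: "p > 1" and mom: "integrable M (\<lambda>x. cmod (Y 1 x) powr p)" and q: "0 < q" "q < p"
  shows "tendsto_L M q (symmetric_mean k c) (\<lambda>_. integral\<^sup>L M (Y 1) ^ k - c)"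
  unfolding tendsto_L_def
proof (intro conjI allI)
  let ?\<mu> = "integral\<^sup>L M (Y 1)"
  have p1: "p \<ge> 1" using p by simp
  show "symmetric_mean k c n \<in> L_space M q" for n
  proof (cases "k \<le> n")
    case False
    then have "symmetric_mean k c n x = 0" for x by (simp add: symmetric_mean_def)
    then show ?thesis using q by (simp add: L_space_def measurable_symmetric_mean)
  next
    case True
    obtain B where B: "\<And>n. n \<ge> k \<Longrightarrow> (\<integral>\<^sup>+x. ennreal (cmod (symmetric_mean k c n x) powr p) \<partial>M) \<le> ennreal B"
      using symmetric_mean_moment_finite[OF p1 mom] by blast
    have "(\<integral>\<^sup>+x. ennreal (cmod (symmetric_mean k c n x) powr q) \<partial>M)
       \<le> (\<integral>\<^sup>+x. 1 + ennreal (cmod (symmetric_mean k c n x) powr p) \<partial>M)"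
      using powr_le_one_plus_powr[of "cmod (symmetric_mean k c n x)" q p for x] q
      by (intro nn_integral_mono) (simp flip: ennreal_plus ennreal_1 add: ennreal_leI)
    also have "\<dots> = 1 + (\<integral>\<^sup>+x. ennreal (cmod (symmetric_mean k c n x) powr p) \<partial>M)"
      by (subst nn_integral_add) (auto simp: emeasure_space_1)
    also have "\<dots> \<le> 1 + ennreal B" by (intro add_left_mono B True)
    also have "\<dots> < \<infinity>" by simp
    finally show ?thesis by (simp add: L_space_def measurable_symmetric_mean)
  qed
  show "(\<lambda>_. ?\<mu> ^ k - c) \<in> L_space M q"
    by (simp add: L_space_def emeasure_space_1)
  obtain B where B: "\<And>n. n \<ge> k \<Longrightarrow> (\<integral>\<^sup>+x. ennreal (cmod (symmetric_mean k (?\<mu> ^ k) n x) powr p) \<partial>M) \<le> ennreal B"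
    using symmetric_mean_moment_finite[OF p1 mom] by blast
  show "(\<lambda>n. \<integral>\<^sup>+x. ennreal (cmod (symmetric_mean k c n x - (?\<mu> ^ k - c)) powr q) \<partial>M) \<longlonglongrightarrow> 0"
  proof (rule moment_tendsto_0_of_AE_of_bounded_moment[OF _ _ _ q])
    show "AE x in M. (\<lambda>n. cmod (symmetric_mean k c n x - (?\<mu> ^ k - c))) \<longlonglongrightarrow> 0"
      using symmetric_mean_AE_tendsto[OF p mom, of k c]
      by eventually_elim (simp add: tendsto_norm_zero_iff LIM_zero_iff)
    show "(\<integral>\<^sup>+x. ennreal (cmod (symmetric_mean k c n x - (?\<mu> ^ k - c)) powr p) \<partial>M) \<le> ennreal B" if "n \<ge> k" for n
      using B[OF that] symmetric_mean_shift[OF that] by simp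
  qed auto
qed

lemma cvariance_symmetric_mean:
  assumes sq: "integrable M (\<lambda>x. (cmod (Y 1 x))\<^sup>2)" and n: "k \<le> n"
  defines "S \<equiv> {L. L \<subseteq> {1..n} \<and> card L = k}"
  defines "V \<equiv> (\<Sum>L\<in>S. \<Sum>L'\<in>S. overlap_covariance (expectation (\<lambda>x. (cmod (Y 1 x))\<^sup>2))
      ((cmod (integral\<^sup>L M (Y 1)))\<^sup>2) k (card (L \<inter> L')))"
  shows "cvariance M (symmetric_mean k c n) = ennreal (V / (real (n choose k))\<^sup>2)"
    and "0 \<le> V"
proof -
  let ?\<mu> = "integral\<^sup>L M (Y 1)" and ?C = "real (n choose k)"
  have S: "finite S" "\<And>L. L \<in> S \<Longrightarrow> finite L \<and> L \<subseteq> {1..} \<and> card L = k"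
    using finite_subset[of _ "{1..n}"] finite_subset[of S "Pow {1..n}"] by (auto simp: S_def)
  have var: "(\<integral>\<^sup>+x. ennreal ((cmod (\<Sum>L\<in>S. (\<Prod>l\<in>L. Y l x) - ?\<mu> ^ k))\<^sup>2) \<partial>M) = ennreal V"
    unfolding V_def by (rule variance_sum_prod(1)[OF sq S])
  show "0 \<le> V" unfolding V_def by (rule variance_sum_prod(2)[OF sq S])
  have sm: "cmod (symmetric_mean k c n x - integral\<^sup>L M (symmetric_mean k c n)) ^ 2
      = (1 / ?C\<^sup>2) * (cmod (\<Sum>L\<in>S. (\<Prod>l\<in>L. Y l x) - ?\<mu> ^ k))\<^sup>2" for x
    unfolding expectation_symmetric_mean[OF integrable_Y1[OF sq] n] symmetric_mean_shift[OF n]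
    by (simp add: symmetric_mean_def S_def norm_divide power_divide)
  have meas: "(\<lambda>x. \<Sum>L\<in>S. (\<Prod>l\<in>L. Y l x) - ?\<mu> ^ k) \<in> borel_measurable M"
    using S by (intro borel_measurable_sum borel_measurable_diff measurable_prod_Y) auto
  have "cvariance M (symmetric_mean k c n)
      = (\<integral>\<^sup>+x. ennreal (1 / ?C\<^sup>2) * ennreal ((cmod (\<Sum>L\<in>S. (\<Prod>l\<in>L. Y l x) - ?\<mu> ^ k))\<^sup>2) \<partial>M)"
    unfolding cvariance_def sm by (intro nn_integral_cong ennreal_mult) auto
  also have "\<dots> = ennreal (1 / ?C\<^sup>2) * (\<integral>\<^sup>+x. ennreal ((cmod (\<Sum>L\<in>S. (\<Prod>l\<in>L. Y l x) - ?\<mu> ^ k))\<^sup>2) \<partial>M)"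
    by (intro nn_integral_cmult measurable_compose[OF meas, where g = "\<lambda>z. ennreal ((cmod z)\<^sup>2)"]) measurable
  also have "\<dots> = ennreal (1 / ?C\<^sup>2 * V)"
    unfolding var using \<open>0 \<le> V\<close> by (intro ennreal_mult[symmetric]) auto
  finally show "cvariance M (symmetric_mean k c n) = ennreal (V / (real (n choose k))\<^sup>2)" by simp
qed

lemma subsets_full_card: "{L. L \<subseteq> {1..k} \<and> card L = k} = {{1..k::nat}}"
  using card_subset_eq[of "{1..k}"] by auto

text \<open>If the product minus a constant were square integrable, so would be the product, whose second moment is
a power of that of \<open>Y 1\<close>.\<close>
lemma cvariance_symmetric_mean_infinite:
  assumes inf: "(\<integral>\<^sup>+x. ennreal ((cmod (Y 1 x))\<^sup>2) \<partial>M) = \<infinity>" and k: "k \<ge> 1"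
  shows "cvariance M (symmetric_mean k c k) = \<infinity>"
proof (rule ccontr)
  let ?P = "\<lambda>x. \<Prod>l\<in>{1..k}. Y l x"
  define d where "d = c + integral\<^sup>L M (symmetric_mean k c k)"
  have [measurable]: "?P \<in> borel_measurable M" by (rule measurable_prod_Y) auto
  assume fin: "cvariance M (symmetric_mean k c k) \<noteq> \<infinity>"
  have "symmetric_mean k c k x - integral\<^sup>L M (symmetric_mean k c k) = ?P x - d" for x
    unfolding symmetric_mean_def subsets_full_card d_def by simp
  then have cv: "cvariance M (symmetric_mean k c k) = (\<integral>\<^sup>+x. ennreal (cmod (?P x - d) powr 2) \<partial>M)"
    unfolding cvariance_def by simp
  have "(\<integral>\<^sup>+x. ennreal (cmod (?P x) powr 2) \<partial>M)
     \<le> (\<integral>\<^sup>+x. ennreal (2 powr 2) * (ennreal (cmod (?P x - d) powr 2) + ennreal (cmod (- d) powr 2)) \<partial>M)"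
  proof (rule nn_integral_mono)
    fix x
    have "cmod (?P x) powr 2 \<le> 2 powr 2 * (cmod (?P x - d) powr 2 + cmod (- d) powr 2)"
      using norm_diff_powr_le[of 2 "?P x - d" "- d"] by simp
    then have "ennreal (cmod (?P x) powr 2) \<le> ennreal (2 powr 2 * (cmod (?P x - d) powr 2 + cmod (- d) powr 2))"
      by (rule ennreal_leI)
    also have "\<dots> = ennreal (2 powr 2) * (ennreal (cmod (?P x - d) powr 2) + ennreal (cmod (- d) powr 2))"
      by (intro ennreal_mult[THEN trans] ennreal_plus arg_cong2[where f = "(*)"] refl) auto
    finally show "ennreal (cmod (?P x) powr 2) \<le> ennreal (2 powr 2) * (ennreal (cmod (?P x - d) powr 2) + ennreal (cmod (- d) powr 2))" .
  qed
  also have "\<dots> = ennreal (2 powr 2) * (\<integral>\<^sup>+x. ennreal (cmod (?P x - d) powr 2) + ennreal (cmod (- d) powr 2) \<partial>M)"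
    by (rule nn_integral_cmult) measurable
  also have "(\<integral>\<^sup>+x. ennreal (cmod (?P x - d) powr 2) + ennreal (cmod (- d) powr 2) \<partial>M)
      = cvariance M (symmetric_mean k c k) + ennreal (cmod (- d) powr 2)"
    unfolding cv by (subst nn_integral_add, measurable) (simp add: emeasure_space_1)
  also have "ennreal (2 powr 2) * (cvariance M (symmetric_mean k c k) + ennreal (cmod (- d) powr 2)) < \<infinity>"
    using fin unfolding infinity_ennreal_def by (intro ennreal_mult_less_top[THEN iffD2]) (auto simp: less_top[symmetric])
  finally have "(\<integral>\<^sup>+x. ennreal (cmod (?P x) powr 2) \<partial>M) < \<infinity>" .
  moreover have "(\<integral>\<^sup>+x. ennreal (cmod (?P x) powr 2) \<partial>M) = \<infinity>"
    using nn_integral_prod_powr[of "{1..k}" 2] inf k by (simp add: top_power_ennreal)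
  ultimately show False by simp
qed

text \<open>When \<open>Y 1\<close> has infinite second moment the lower bound is \<open>0\<close>, because its denominator is infinite, and
the upper bound is \<open>\<infinity>\<close>. When \<open>Y 1\<close> vanishes almost surely, so does the variance of the single product.
In the remaining case both bounds are statements about real numbers.\<close>
lemma cvariance_symmetric_mean_bounds:
  assumes k: "k \<ge> 1" and n: "k \<le> n"
  defines "E2 \<equiv> (\<integral>\<^sup>+x. ennreal ((cmod (Y 1 x))\<^sup>2) \<partial>M)"
  shows "of_nat k * cvariance M (symmetric_mean k c k) * (ennreal (cmod (integral\<^sup>L M (Y 1))) ^ (2 * k) / E2 ^ k)
        \<le> of_nat n * cvariance M (symmetric_mean k c n)" (is "?lower")
    and "of_nat n * cvariance M (symmetric_mean k c n) \<le> of_nat k * cvariance M (symmetric_mean k c k)" (is "?upper")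
proof -
  have "?lower \<and> ?upper"
  proof (cases "E2 = \<infinity>")
    case True
    then have "cvariance M (symmetric_mean k c k) = \<infinity>"
      using cvariance_symmetric_mean_infinite[OF _ k] by (simp add: E2_def)
    then show ?thesis
      using True k by (simp add: top_power_ennreal ennreal_mult_top ennreal_power of_nat_eq_0_iff)
  next
    case False
    have sq: "integrable M (\<lambda>x. (cmod (Y 1 x))\<^sup>2)"
    proof (rule integrableI_nonneg)
      show "(\<integral>\<^sup>+x. ennreal ((cmod (Y 1 x))\<^sup>2) \<partial>M) < \<infinity>" using False by (simp add: E2_def less_top)
      show "(\<lambda>x. (cmod (Y 1 x))\<^sup>2) \<in> borel_measurable M" using measurable_Y1 by measurable
    qed simp
    define s where "s = expectation (\<lambda>x. (cmod (Y 1 x))\<^sup>2)"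
    define t where "t = (cmod (integral\<^sup>L M (Y 1)))\<^sup>2"
    let ?f = "overlap_covariance s t k"
    have E2: "E2 = ennreal s" unfolding E2_def s_def by (rule nn_integral_eq_integral[OF sq]) simp
    have st: "0 \<le> t" "t \<le> s" unfolding t_def s_def using cmod_mean_squared_le[OF sq] by auto
    define W where "W = (\<Sum>L\<in>{L. L \<subseteq> {1..n} \<and> card L = k}. \<Sum>L'\<in>{L. L \<subseteq> {1..n} \<and> card L = k}. ?f (card (L \<inter> L'))) / (real (n choose k))\<^sup>2"
    have Rn: "cvariance M (symmetric_mean k c n) = ennreal W" and W0: "0 \<le> W"
      using cvariance_symmetric_mean[OF sq n] unfolding W_def s_def t_def by auto
    have G: "cvariance M (symmetric_mean k c k) = ennreal (?f k)" and G0: "0 \<le> ?f k"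
      using cvariance_symmetric_mean[OF sq order_refl, of k] unfolding subsets_full_card s_def t_def by auto
    have lo: "(real k)\<^sup>2 * ?f 1 \<le> real n * W" and up: "real n * W \<le> real k * ?f k"
      using variance_sum_prod_bounds[OF sq k n] unfolding W_def s_def t_def by auto
    have tk: "ennreal (cmod (integral\<^sup>L M (Y 1))) ^ (2 * k) = ennreal (t ^ k)"
      by (simp add: t_def ennreal_power power_mult)
    have ?upper
      unfolding Rn G ennreal_of_nat_eq_real_of_nat using up W0 G0 by (simp flip: ennreal_mult add: ennreal_leI)
    moreover have ?lower
    proof (cases "s = 0")
      case True
      then have "?f k = 0" using st k by (simp add: overlap_covariance_def)
      then show ?thesis unfolding G by simp
    next
      case False
      then have s: "s > 0" using st by simp
      have ratio: "ennreal (t ^ k) / ennreal s ^ k = ennreal (t ^ k / s ^ k)"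
        using s st by (simp add: ennreal_power divide_ennreal)
      have "real k * ?f k * (t ^ k / s ^ k) \<le> real k * (real k * ?f 1)"
        unfolding mult.assoc by (intro mult_left_mono variance_ratio_bound s st k) simp
      also have "\<dots> \<le> real n * W" using lo by (simp add: power2_eq_square mult.assoc)
      finally have "real k * ?f k * (t ^ k / s ^ k) \<le> real n * W" .
      then show ?thesis
        unfolding Rn G tk E2 ratio ennreal_of_nat_eq_real_of_nat using W0 G0 s st
        by (simp only: ennreal_mult[symmetric] of_nat_0_le_iff mult_nonneg_nonneg divide_nonneg_nonneg zero_le_power less_imp_le ennreal_leI)
    qed
    ultimately show ?thesis by simp
  qed
  then show ?lower ?upper by auto
qed

end

section \<open>Principal roots of shifted real variables\<close>
text \<open>The principal power is continuous off the closed negative real axis and, for a positive exponent, also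
continuous along it; only the passage across the axis is discontinuous.\<close>
lemma borel_measurable_powr_of_real:
  assumes q: "q > 0"
  shows "(\<lambda>z::complex. z powr of_real q) \<in> borel_measurable borel"
proof -
  have "(\<lambda>z::complex. if z \<in> \<real>\<^sub>\<le>\<^sub>0 then of_real (\<bar>Re z\<bar> powr q) * exp (\<i> * pi * q) else z powr of_real q) \<in> borel_measurable borel"
  proof (rule borel_measurable_continuous_on_if)
    show "(\<real>\<^sub>\<le>\<^sub>0 :: complex set) \<in> sets borel" by (intro borel_closed) simp
    show "continuous_on \<real>\<^sub>\<le>\<^sub>0 (\<lambda>z::complex. of_real (\<bar>Re z\<bar> powr q) * exp (\<i> * pi * q))"
      using q by (intro continuous_intros continuous_on_powr') auto
    show "continuous_on (- \<real>\<^sub>\<le>\<^sub>0) (\<lambda>z::complex. z powr of_real q)"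
      using q by (intro continuous_intros) (auto simp: complex_nonpos_Reals_iff)
  qed
  moreover have "(if z \<in> \<real>\<^sub>\<le>\<^sub>0 then of_real (\<bar>Re z\<bar> powr q) * exp (\<i> * pi * q) else z powr of_real q) = z powr of_real q" for z :: complex
  proof (cases "z \<in> \<real>\<^sub>\<le>\<^sub>0")
    case True
    then obtain x where "z = of_real x" "x \<le> 0" by (auto elim: nonpos_Reals_cases)
    then show ?thesis using True by (auto simp: powr_of_real_if)
  qed simp
  ultimately show ?thesis by simp
qed

lemma measurable_root_rv:
  assumes "m > 0"
  shows "root_rv \<alpha> m \<in> borel_measurable borel"
proof -
  have "(\<lambda>z::complex. z powr of_real (1 / real m)) \<in> borel_measurable borel"
    using assms by (intro borel_measurable_powr_of_real) simp
  then show ?thesis unfolding root_rv_def[abs_def] by measurable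
qed

lemma cmod_root_rv: "cmod (root_rv \<alpha> m x) = cmod (of_real x + \<alpha>) powr (1 / real m)"
  unfolding root_rv_def by (subst norm_powr_real_powr') auto

lemma (in prob_space) iid_complex_sequence_comp:
  fixes X :: "nat \<Rightarrow> 'a \<Rightarrow> real"
  assumes indep: "indep_vars (\<lambda>_. borel) X {1..}"
    and ident: "\<And>i. i \<ge> 1 \<Longrightarrow> distr M borel (X i) = distr M borel (X 1)"
    and g: "g \<in> borel_measurable borel"
  shows "iid_complex_sequence M (\<lambda>i x. g (X i x))"
proof
  show "indep_vars (\<lambda>_. borel) (\<lambda>i x. g (X i x)) {1..}"
    by (rule indep_vars_compose2[OF indep g])
  fix i :: nat assume i: "i \<ge> 1"
  have "distr M borel (\<lambda>x. g (X j x)) = distr (distr M borel (X j)) borel g" if "j \<ge> 1" for j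
    using distr_distr[OF g, of "X j" M] indep that by (simp add: comp_def indep_vars_def)
  from this[OF i] this[of 1] show "distr M borel (\<lambda>x. g (X i x)) = distr M borel (\<lambda>x. g (X 1 x))"
    using ident[OF i] by simp
qed

text \<open>Raising an \<open>m\<close>-th root to the power \<open>m * u\<close> returns \<open>cmod (X + \<alpha>) powr u\<close>, so taking roots multiplies
the order of the available moment by \<open>m\<close>.\<close>
lemma root_moment_integrable:
  fixes X :: "'a \<Rightarrow> real"
  assumes M: "prob_space M" and m: "m > 0" and u: "u \<ge> 0" and X: "X \<in> L_space M u"
  shows "integrable M (\<lambda>x. cmod (root_rv \<alpha> m (X x)) powr (real m * u))"
proof (rule Bochner_Integration.integrable_bound)
  interpret prob_space M by fact
  have [measurable]: "X \<in> borel_measurable M" and fin: "(\<integral>\<^sup>+x. ennreal (norm (X x) powr u) \<partial>M) < \<infinity>"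
    using X by (auto simp: L_space_def)
  have "integrable M (\<lambda>x. norm (X x) powr u)"
    using fin by (intro integrableI_nonneg) auto
  then show "integrable M (\<lambda>x. 2 powr u * (norm (X x) powr u + cmod (- \<alpha>) powr u))" by simp
  show "(\<lambda>x. cmod (root_rv \<alpha> m (X x)) powr (real m * u)) \<in> borel_measurable M"
    using measurable_root_rv[OF m, of \<alpha>] by measurable
  show "AE x in M. norm (cmod (root_rv \<alpha> m (X x)) powr (real m * u)) \<le> norm (2 powr u * (norm (X x) powr u + cmod (- \<alpha>) powr u))"
  proof (rule AE_I2)
    fix x
    have "cmod (root_rv \<alpha> m (X x)) powr (real m * u) = cmod (of_real (X x) - (- \<alpha>)) powr u"
      unfolding cmod_root_rv powr_powr using m by simp
    also have "\<dots> \<le> 2 powr u * (norm (X x) powr u + cmod (- \<alpha>) powr u)"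
      using norm_diff_powr_le[OF u, of "of_real (X x)" "- \<alpha>"] by simp
    finally show "norm (cmod (root_rv \<alpha> m (X x)) powr (real m * u)) \<le> norm (2 powr u * (norm (X x) powr u + cmod (- \<alpha>) powr u))"
      by simp
  qed
qed

theorem theorem6p3:
  fixes M :: "'a measure" and X :: "nat \<Rightarrow> 'a \<Rightarrow> real" and \<alpha> :: complex and m :: nat
  assumes "prob_space M"
    and "prob_space.indep_vars M (\<lambda>_. borel) X {1..}"
    and "\<And>i. i \<ge> 1 \<Longrightarrow> distr M borel (X i) = distr M borel (X 1)"
    and "\<And>i. i \<ge> 1 \<Longrightarrow> continuous_rv M (X i)"
    and "Im \<alpha> \<ge> 0"
    and "m \<ge> 2"
    and "X 1 \<in> L_space M (2 * real m / (2 * real m + 1))"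
  shows
    "(AE \<omega> in M. (\<lambda>n. R_stat X \<alpha> m n \<omega>) \<longlonglongrightarrow> integral\<^sup>L M (G_stat X \<alpha> m)) \<and>
     tendsto_L M (real m - 1) (R_stat X \<alpha> m) (\<lambda>_. integral\<^sup>L M (G_stat X \<alpha> m)) \<and>
     (\<forall>n\<ge>m.
        of_nat m * cvariance M (G_stat X \<alpha> m) *
          (ennreal (cmod (\<integral>\<omega>. root_rv \<alpha> m (X 1 \<omega>) \<partial>M)) ^ (2 * m) /
           (\<integral>\<^sup>+ \<omega>. ennreal (cmod (complex_of_real (X 1 \<omega>) + \<alpha>) powr (2 / real m)) \<partial>M) ^ m)
        \<le> of_nat n * cvariance M (R_stat X \<alpha> m n) \<and>
        of_nat n * cvariance M (R_stat X \<alpha> m n) \<le> of_nat m * cvariance M (G_stat X \<alpha> m))"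
proof -
  interpret prob_space M by fact
  have m: "m \<ge> 2" by fact
  interpret Y: iid_complex_sequence M "\<lambda>i \<omega>. root_rv \<alpha> m (X i \<omega>)"
    by (rule iid_complex_sequence_comp[OF assms(2) assms(3) measurable_root_rv]) (use m in simp_all)
  define u where "u = 2 * real m / (2 * real m + 1)"
  have u: "real m * u = real m * (2 * real m) / (2 * real m + 1)" by (simp add: u_def)
  \<comment> \<open>For u = 2m/(2m+1) and m at least 2, the order m*u exceeds both 1 and m-1.\<close>
  have mm: "2 * real m \<le> real m * real m" using m by (intro mult_right_mono) auto
  then have "2 * real m + 1 < real m * (2 * real m)" using m by linarith
  then have p1: "real m * u > 1" unfolding u by (simp add: less_divide_eq)
  have "(real m - 1) * (2 * real m + 1) = real m * (2 * real m) - real m - 1" by (simp add: algebra_simps)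
  then have pq: "real m - 1 < real m * u" unfolding u by (simp add: less_divide_eq)
  have mom: "integrable M (\<lambda>\<omega>. cmod (root_rv \<alpha> m (X 1 \<omega>)) powr (real m * u))"
    using assms(1,7) m by (intro root_moment_integrable) (auto simp: u_def)
  have R: "R_stat X \<alpha> m = Y.symmetric_mean m \<alpha>"
    by (simp add: fun_eq_iff R_stat_def Y.symmetric_mean_def)
  have G: "G_stat X \<alpha> m = Y.symmetric_mean m \<alpha> m"
    unfolding fun_eq_iff G_stat_def Y.symmetric_mean_def Y.subsets_full_card by simp
  have EG: "integral\<^sup>L M (G_stat X \<alpha> m) = (\<integral>\<omega>. root_rv \<alpha> m (X 1 \<omega>) \<partial>M) ^ m - \<alpha>"
    unfolding G using p1 by (intro Y.expectation_symmetric_mean Y.integrable_of_moment[OF _ mom]) auto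
  have sq: "cmod (complex_of_real x + \<alpha>) powr (2 / real m) = (cmod (root_rv \<alpha> m x))\<^sup>2" for x
    unfolding cmod_root_rv power2_eq_square powr_add[symmetric] by simp
  show ?thesis
    unfolding EG R sq
  proof (intro conjI allI impI)
    show "AE \<omega> in M. (\<lambda>n. Y.symmetric_mean m \<alpha> n \<omega>) \<longlonglongrightarrow> (\<integral>\<omega>. root_rv \<alpha> m (X 1 \<omega>) \<partial>M) ^ m - \<alpha>"
      by (rule Y.symmetric_mean_AE_tendsto[OF p1 mom])
    show "tendsto_L M (real m - 1) (Y.symmetric_mean m \<alpha>) (\<lambda>_. (\<integral>\<omega>. root_rv \<alpha> m (X 1 \<omega>) \<partial>M) ^ m - \<alpha>)"
      using m by (intro Y.symmetric_mean_tendsto_L[OF p1 mom _ pq]) simp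
  next
    fix n assume n: "m \<le> n"
    have m1: "1 \<le> m" using m by simp
    show "of_nat m * cvariance M (G_stat X \<alpha> m) *
          (ennreal (cmod (\<integral>\<omega>. root_rv \<alpha> m (X 1 \<omega>) \<partial>M)) ^ (2 * m) /
           (\<integral>\<^sup>+ \<omega>. ennreal ((cmod (root_rv \<alpha> m (X 1 \<omega>)))\<^sup>2) \<partial>M) ^ m)
        \<le> of_nat n * cvariance M (Y.symmetric_mean m \<alpha> n)"
      unfolding G by (rule Y.cvariance_symmetric_mean_bounds(1)[OF m1 n])
    show "of_nat n * cvariance M (Y.symmetric_mean m \<alpha> n) \<le> of_nat m * cvariance M (G_stat X \<alpha> m)"
      unfolding G by (rule Y.cvariance_symmetric_mean_bounds(2)[OF m1 n])
  qed
qed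

end
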